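(* Consider the spatial autoregressive error model (SEM) $\mathbb{X}\mid\mathbf{Y}=1_n\mu^T+\mathbb{F}(AB)^T+\mathbb{E}$, $\mathrm{vec}(\mathbb{E}^T)\sim\mathcal{N}(0_{np},W_\theta^{-2}\otimes\Delta)$, where $W_\theta=I_n-\theta W$, with parameters $\mu\in\mathbb{R}^p$, $A\in\mathbb{R}^{p\times d}$, $B\in\mathbb{R}^{d\times r}$ ($d\le p$) and $\Delta\in\mathbb{R}^{p\times p}$ positive definite, whose log-likelihood is $$ l(\mathbb{X}\mid\mathbf{Y};\mu,A,B,\Delta,\theta)=-\frac{np}{2}\log(2\pi)-\frac n2\log|\Delta|+p\log|W_\theta|-\frac12\mathrm{tr}\Big(W_\theta(\mathbb{X}-1_n\mu^T-\mathbb{F}B^TA^T)\Delta^{-1}(\mathbb{X}-1_n\mu^T-\mathbb{F}B^TA^T)^TW_\theta\Big).$$ Put $$W_\theta^c=I_n-(1_n^TW_\theta^21_n)^{-1}1_n1_n^TW_\theta^2,\qquad \bar{\mathbb{X}}=W_\theta W_\theta^c\mathbb{X},\qquad \bar{\mathbb{F}}=W_\theta W_\theta^c\mathbb{F},$$ $$\widehat\Sigma_{\bar X,\bar F}=\tfrac1n\bar{\mathbb{X}}^T\bar{\mathbb{F}},\quad \widehat\Sigma_{\bar F,\bar X}=\widehat\Sigma_{\bar X,\bar F}^T,\quad \widehat\Sigma_{\bar F,\bar F}=\tfrac1n\bar{\mathbb{F}}^T\bar{\mathbb{F}},\quad \widehat C_{LS}=\tfrac1n\widehat\Sigma_{\bar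 X,\bar F}\widehat\Sigma_{\bar F,\bar F}^{-1},$$ $$\widehat\Delta_{LS}=\tfrac1n(\bar{\mathbb{X}}-\bar{\mathbb{F}}\widehat C_{LS}^T)^T(\bar{\mathbb{X}}-\bar{\mathbb{F}}\widehat C_{LS}^T),$$ and let $\widehat V_{(d)}=[\widehat V_1,\dots,\widehat V_d]$, where $\widehat V_j$ is the (orthonormal) eigenvector corresponding to the $j$-th largest eigenvalue $\lambda_j^2$ of $$\widehat\Sigma=\widehat\Delta_{LS}^{-1/2}\,\widehat\Sigma_{\bar X,\bar F}\,\widehat\Sigma_{\bar F,\bar F}^{-1}\,\widehat\Sigma_{\bar F,\bar X}\,\widehat\Delta_{LS}^{-1/2}.$$ Then, given the matrix $W$ and the coefficient $\theta$, the maximum likelihood estimators of the parameters of the SEM model are given by $$\widehat A=\widehat\Delta_{LS}^{-1/2}\widehat V_{(d)},\qquad \widehat B=\widehat V_{(d)}^T\widehat\Delta_{LS}^{1/2}\widehat\Sigma_{\bar X,\bar F}\widehat\Sigma_{\bar F,\bar F}^{-1},$$ $$\widehat\mu=(\mathbb{X}^T-\widehat A\widehat B\mathbb{F}^T)W_\theta^21_n(1_n^TW_\theta^21_n)^{-1},$$ $$\widehat\Delta=\frac1n(\bar{\mathbb{X}}^T-\widehat A\widehat B\bar{\mathbb{F}}^T)(\bar{\mathbb{X}}^T-\widehat A\widehat B\bar{\mathbb{F}}^T)^T.$$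
   Context: The rows of $\mathbb{X}\in\mathbb{R}^{n\times p}$ are the vectors of $p$ continuous predictors observed at spatial locations $s_1,\dots,s_n\in D\subset\mathbb{R}^2$; $\mathbf{Y}=(Y_{s_1},\dots,Y_{s_n})^T\in\mathbb{R}^n$ is the vector of responses; the rows of $\mathbb{F}\in\mathbb{R}^{n\times r}$ are $f_{Y_{s_i}}^T$ for known functions $f_{Y_{s_i}}\in\mathbb{R}^r$ of $Y_{s_i}$. The error matrix $\mathbb{E}\in\mathbb{R}^{n\times p}$ has the autoregressive structure $\mathbb{E}=\theta W\mathbb{E}+\mathbb{U}$, i.e. $\mathbb{E}=W_\theta^{-1}\mathbb{U}$ ($W_\theta$ being invertible), with $\mathrm{vec}(\mathbb{U}^T)\sim\mathcal{N}(0_{np},I_n\otimes\Delta)$; the covariance of $\mathrm{vec}(\mathbb{E}^T)$ is taken to be $W_\theta^{-2}\otimes\Delta$. $\theta$ is the coefficient of the spatially lagged error and $W\in\mathbb{R}^{n\times n}$ is the spatial weight matrix: $W_{ij}$ is first set to $1$ if the distance between sites $i$ and $j$ is at most $d_{max}$ (a distance for which every point has at least one neighbor) and to $0$ otherwise, and $W$ is then normalized by columns so that the weights sum to 1. $1_n$ is the $n$-vector of ones, $I_n$ the $n\times n$ identity, $|M|$ the determinant of $M$, and $M^{1/2}$, $M^{-1/2}$ the symmetric square root of a positive definite matrix $M$ and its inverse. The matrices $\widehat\Sigma_{\bar F,\bar F}$ and $\widehat\Delta_{LS}$ are taken to be invertible, so that the formulas make sense.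
   Formalization: The exponents of Δ̂_LS in Â and B̂ are exchanged (Â uses 1/2, B̂ uses -1/2), the factor 1/n in Ĉ_LS is dropped, W_θ^{-1}U is assumed to have covariance exactly W_θ^{-2}⊗Δ (so W_θ is symmetric), and log|W_θ| uses the absolute value of the determinant. *)

theory Defs
  imports "HOL-Analysis.Analysis"
begin

section \<open>Matrices\<close>

definition outer :: "real^'m \<Rightarrow> real^'k \<Rightarrow> real^'k^'m" where
  "outer u v = (\<chi> i j. u $ i * v $ j)"

definition pos_def :: "real^'k^'k \<Rightarrow> bool" where
  "pos_def M \<longleftrightarrow> transpose M = M \<and> (\<forall>x. x \<noteq> 0 \<longrightarrow> 0 < x \<bullet> (M *v x))"

text \<open>The symmetric square root is only meaningful for positive definite arguments, where it is
  the unique positive definite matrix with the given square.\<close>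
definition msqrt :: "real^'k^'k \<Rightarrow> real^'k^'k" where
  "msqrt M = (THE R. pos_def R \<and> R ** R = M)"

definition kron :: "real^'m^'m \<Rightarrow> real^'k^'k \<Rightarrow> real^('m \<times> 'k)^('m \<times> 'k)" where
  "kron K M = (\<chi> a b. K $ fst a $ fst b * M $ snd a $ snd b)"

text \<open>\<open>vec\<close> of the transpose: the rows of the matrix are stacked, which matches the index order
  of \<^const>\<open>kron\<close>.\<close>
definition vec_rows :: "real^'k^'m \<Rightarrow> real^('m \<times> 'k)" where
  "vec_rows M = (\<chi> a. M $ fst a $ snd a)"

text \<open>The columns of \<open>V\<close> are orthonormal eigenvectors of the symmetric matrix \<open>M\<close> for its
  \<open>CARD('d)\<close> largest eigenvalues, counted with multiplicity: \<open>v 0, v 1, \<dots>\<close> is an orthonormal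
  eigenbasis ordered by decreasing eigenvalue \<open>(lam j)\<^sup>2\<close>, and \<open>e\<close> numbers the column indices
  (a finite type carries no canonical order). Ties are broken arbitrarily.\<close>
definition leading_eigenvectors :: "real^'p^'p \<Rightarrow> real^'d^'p \<Rightarrow> bool" where
  "leading_eigenvectors M V \<longleftrightarrow>
     (\<exists>(v :: nat \<Rightarrow> real^'p) (lam :: nat \<Rightarrow> real) (e :: 'd \<Rightarrow> nat).
        (\<forall>i<CARD('p). \<forall>j<CARD('p). v i \<bullet> v j = (if i = j then 1 else 0)) \<and>
        (\<forall>j<CARD('p). M *v v j = (lam j)\<^sup>2 *\<^sub>R v j) \<and>
        (\<forall>i j. i \<le> j \<longrightarrow> j < CARD('p) \<longrightarrow> (lam j)\<^sup>2 \<le> (lam i)\<^sup>2) \<and>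
        bij_betw e UNIV {..<CARD('d)} \<and>
        V = (\<chi> i k. v (e k) $ i))"

text \<open>Density of the multivariate normal distribution with mean \<open>m\<close> and covariance \<open>S\<close>.\<close>
definition mvn_density :: "real^'k \<Rightarrow> real^'k^'k \<Rightarrow> real^'k \<Rightarrow> real" where
  "mvn_density m S x =
     exp (- (1/2) * ((x - m) \<bullet> (matrix_inv S *v (x - m)))) / sqrt ((2 * pi) ^ CARD('k) * det S)"


section \<open>The spatial error model\<close>

text \<open>The value \<open>c\<close> on the diagonal covers both conventions: a site counts as its own neighbour
  (\<open>c = 1\<close>, the distance being 0) or not (\<open>c = 0\<close>).\<close>
definition neighbour_matrix :: "real \<Rightarrow> ('n \<Rightarrow> real^2) \<Rightarrow> real \<Rightarrow> real^'n^'n" where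
  "neighbour_matrix c s dmax =
     (\<chi> i j. if i = j then c else if dist (s i) (s j) \<le> dmax then 1 else 0)"

definition normalize_columns :: "real^'n^'n \<Rightarrow> real^'n^'n" where
  "normalize_columns N = (\<chi> i j. N $ i $ j / (\<Sum>k\<in>UNIV. N $ k $ j))"

definition spatial_weight_matrix :: "('n \<Rightarrow> real^2) \<Rightarrow> real \<Rightarrow> real^'n^'n \<Rightarrow> bool" where
  "spatial_weight_matrix s dmax W \<longleftrightarrow>
     (\<forall>i. \<exists>j. j \<noteq> i \<and> dist (s i) (s j) \<le> dmax) \<and>
     (\<exists>c\<in>{0, 1}. W = normalize_columns (neighbour_matrix c s dmax))"

definition W_of :: "real \<Rightarrow> real^'n^'n \<Rightarrow> real^'n^'n" where
  "W_of \<theta> W = mat 1 - \<theta> *\<^sub>R W"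

text \<open>The covariance of \<open>vec(E\<^sup>T)\<close> for \<open>E = W_of \<theta> W\<^sup>-\<^sup>1 U\<close> with \<open>vec(U\<^sup>T) \<sim> N(0, I \<otimes> \<Delta>)\<close>, using
  \<open>vec(E\<^sup>T) = (W_of \<theta> W\<^sup>-\<^sup>1 \<otimes> I) vec(U\<^sup>T)\<close>.\<close>
definition sem_error_cov :: "real \<Rightarrow> real^'n^'n \<Rightarrow> real^'p^'p \<Rightarrow> real^('n \<times> 'p)^('n \<times> 'p)" where
  "sem_error_cov \<theta> W \<Delta> =
     kron (matrix_inv (W_of \<theta> W)) (mat 1) ** kron (mat 1) \<Delta>
       ** transpose (kron (matrix_inv (W_of \<theta> W)) (mat 1))"

definition sem_mean :: "real^'r^'n \<Rightarrow> real^'p \<Rightarrow> real^'d^'p \<Rightarrow> real^'r^'d \<Rightarrow> real^'p^'n" where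
  "sem_mean F \<mu> A B = outer 1 \<mu> + F ** transpose (A ** B)"

definition sem_loglik ::
  "real \<Rightarrow> real^'n^'n \<Rightarrow> real^'r^'n \<Rightarrow> real^'p^'n
    \<Rightarrow> real^'p \<Rightarrow> real^'d^'p \<Rightarrow> real^'r^'d \<Rightarrow> real^'p^'p \<Rightarrow> real" where
  "sem_loglik \<theta> W F X \<mu> A B \<Delta> =
     ln (mvn_density (vec_rows (sem_mean F \<mu> A B))
                     (kron (matrix_inv (W_of \<theta> W ** W_of \<theta> W)) \<Delta>)
                     (vec_rows X))"


section \<open>The estimators\<close>

definition W_center :: "real \<Rightarrow> real^'n^'n \<Rightarrow> real^'n^'n" where
  "W_center \<theta> W =
     mat 1 - inverse (1 \<bullet> ((W_of \<theta> W ** W_of \<theta> W) *v 1)) *\<^sub>R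
               (outer 1 1 ** (W_of \<theta> W ** W_of \<theta> W))"

definition sem_bar :: "real \<Rightarrow> real^'n^'n \<Rightarrow> real^'k^'n \<Rightarrow> real^'k^'n" where
  "sem_bar \<theta> W M = W_of \<theta> W ** W_center \<theta> W ** M"

definition Sigma_hat :: "real^'k^'n \<Rightarrow> real^'l^'n \<Rightarrow> real^'l^'k" where
  "Sigma_hat P Q = (1 / real CARD('n)) *\<^sub>R (transpose P ** Q)"

text \<open>The least squares coefficient of the regression of \<open>Xb\<close> on \<open>Fb\<close>. The factors \<open>1/n\<close> inside
  the two matrices \<^const>\<open>Sigma_hat\<close> cancel, so there is no further factor \<open>1/n\<close>.\<close>
definition C_LS :: "real^'p^'n \<Rightarrow> real^'r^'n \<Rightarrow> real^'r^'p" where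
  "C_LS Xb Fb = Sigma_hat Xb Fb ** matrix_inv (Sigma_hat Fb Fb)"

definition Delta_LS :: "real^'p^'n \<Rightarrow> real^'r^'n \<Rightarrow> real^'p^'p" where
  "Delta_LS Xb Fb =
     (1 / real CARD('n)) *\<^sub>R
       (transpose (Xb - Fb ** transpose (C_LS Xb Fb)) ** (Xb - Fb ** transpose (C_LS Xb Fb)))"

definition Sigma_fit :: "real^'p^'n \<Rightarrow> real^'r^'n \<Rightarrow> real^'p^'p" where
  "Sigma_fit Xb Fb =
     matrix_inv (msqrt (Delta_LS Xb Fb)) ** Sigma_hat Xb Fb ** matrix_inv (Sigma_hat Fb Fb)
       ** transpose (Sigma_hat Xb Fb) ** matrix_inv (msqrt (Delta_LS Xb Fb))"

text \<open>Reduced rank regression: \<open>A_hat ** B_hat\<close> is the oblique projection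
  \<open>\<Delta>\<^sup>1\<^sup>/\<^sup>2 V V\<^sup>T \<Delta>\<^sup>-\<^sup>1\<^sup>/\<^sup>2\<close> applied to the least squares coefficient, \<open>\<Delta>\<close> being \<^const>\<open>Delta_LS\<close>.
  With the exponents \<open>1/2\<close> and \<open>-1/2\<close> the other way round, the likelihood is in general not
  maximized.\<close>
definition A_hat :: "real^'p^'n \<Rightarrow> real^'r^'n \<Rightarrow> real^'d^'p \<Rightarrow> real^'d^'p" where
  "A_hat Xb Fb V = msqrt (Delta_LS Xb Fb) ** V"

definition B_hat :: "real^'p^'n \<Rightarrow> real^'r^'n \<Rightarrow> real^'d^'p \<Rightarrow> real^'r^'d" where
  "B_hat Xb Fb V =
     transpose V ** matrix_inv (msqrt (Delta_LS Xb Fb)) ** Sigma_hat Xb Fb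
       ** matrix_inv (Sigma_hat Fb Fb)"

definition mu_hat ::
  "real \<Rightarrow> real^'n^'n \<Rightarrow> real^'p^'n \<Rightarrow> real^'r^'n \<Rightarrow> real^'d^'p \<Rightarrow> real^'r^'d \<Rightarrow> real^'p" where
  "mu_hat \<theta> W X F A B =
     inverse (1 \<bullet> ((W_of \<theta> W ** W_of \<theta> W) *v 1)) *\<^sub>R
       ((transpose X - A ** B ** transpose F) *v ((W_of \<theta> W ** W_of \<theta> W) *v 1))"

definition Delta_hat ::
  "real^'p^'n \<Rightarrow> real^'r^'n \<Rightarrow> real^'d^'p \<Rightarrow> real^'r^'d \<Rightarrow> real^'p^'p" where
  "Delta_hat Xb Fb A B =
     (1 / real CARD('n)) *\<^sub>R
       ((transpose Xb - A ** B ** transpose Fb) **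
        transpose (transpose Xb - A ** B ** transpose Fb))"

end

theory Submission
  imports Defs
begin

text \<open>
  Centring replaces the sum of squares by its value at the optimal \<open>\<mu>\<close> plus a positive semidefinite
  term. For fixed \<open>C = A B\<close> the Gaussian likelihood is then maximal when \<open>\<Delta>\<close> is the residual covariance,
  so that only the determinant of the latter remains to be minimized over matrices \<open>C\<close> of rank at
  most \<open>d\<close>. By orthogonality of the least squares residuals and the substitution
  \<open>K = \<Delta>\<^sub>L\<^sub>S\<^sup>-\<^sup>1\<^sup>/\<^sup>2 C\<^sub>L\<^sub>S \<Sigma>\<^sup>1\<^sup>/\<^sup>2\<close>, with \<open>\<Sigma>\<close> the covariance of the centred regressors, this amounts
  to minimizing \<open>det (I + (K - G)(K - G)\<^sup>T)\<close> over \<open>G\<close> of rank at most \<open>d\<close>. By Weyl's inequality the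
  \<open>j\<close>-th eigenvalue of \<open>(K - G)(K - G)\<^sup>T\<close> is at least the \<open>(j + d)\<close>-th eigenvalue of \<open>K K\<^sup>T\<close>, and
  projecting \<open>K\<close> onto its \<open>d\<close> leading left singular vectors attains all these bounds at once.
\<close>

text \<open>As a simp rule it would turn products with a transpose into \<open>v*\<close>, while all
  arguments below keep to \<open>*v\<close>.\<close>

declare transpose_matrix_vector [simp del]

section \<open>Linearity of matrix products, transposes and traces\<close>

lemma matrix_mul_scaleR:
  fixes A :: "real^'m^'n"
  shows "(k *\<^sub>R A) ** B = k *\<^sub>R (A ** B)" "A ** (k *\<^sub>R B) = k *\<^sub>R (A ** B)"
  by (simp_all only: matrix_scalar_ac scalar_matrix_assoc)

lemma matrix_add_rdistrib: "(A + B) ** C = A ** C + B ** C" for A :: "real^'m^'n"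
  by (simp add: matrix_matrix_mult_def vec_eq_iff distrib_right sum.distrib)

lemma matrix_diff_ldistrib: "A ** (B - C) = A ** B - A ** C" for A :: "real^'m^'n"
  by (simp add: matrix_matrix_mult_def vec_eq_iff right_diff_distrib sum_subtractf)

lemma matrix_diff_rdistrib: "(A - B) ** C = A ** C - B ** C" for A :: "real^'m^'n"
  by (simp add: matrix_matrix_mult_def vec_eq_iff left_diff_distrib sum_subtractf)

lemma transpose_add: "transpose (A + B) = transpose A + transpose B"
  by (simp add: transpose_def vec_eq_iff)

lemma transpose_diff: "transpose (A - B) = transpose A - transpose (B :: real^'k^'m)"
  by (simp add: transpose_def vec_eq_iff)

lemma trace_scaleR: "trace (c *\<^sub>R M) = c * trace (M :: real^'k^'k)"
  by (simp add: trace_def sum_distrib_left)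

section \<open>Spectral theorem for symmetric matrices\<close>

text \<open>Indices are naturals below \<open>CARD('k)\<close> rather than elements of
  \<open>'k\<close>: this orders the eigenvalues, so that shifting an index by the rank makes sense.
  Values beyond the dimension are arbitrary.\<close>

definition orthonormal_seq :: "(nat \<Rightarrow> real^'k) \<Rightarrow> bool" where
  "orthonormal_seq u \<longleftrightarrow>
     (\<forall>i<CARD('k). \<forall>j<CARD('k). u i \<bullet> u j = (if i = j then 1 else 0))"

definition eigenbasis :: "real^'k^'k \<Rightarrow> (nat \<Rightarrow> real^'k) \<Rightarrow> (nat \<Rightarrow> real) \<Rightarrow> bool" where
  "eigenbasis M u l \<longleftrightarrow> orthonormal_seq u \<and> (\<forall>j<CARD('k). M *v u j = l j *\<^sub>R u j)"

lemma inner_matrix_transpose: "x \<bullet> (M *v y) = (transpose M *v x) \<bullet> y" for M :: "real^'k^'m"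
  by (simp add: transpose_matrix_vector dot_lmul_matrix)

lemma inner_symmetric_matrix:
  fixes M :: "real^'k^'k"
  assumes "transpose M = M"
  shows "x \<bullet> (M *v y) = y \<bullet> (M *v x)"
  by (metis assms inner_commute inner_matrix_transpose)

text \<open>Supplies nonzero vectors twice: for the next eigenvector in the spectral theorem and for
  the dimension count behind Weyl's inequality.\<close>

lemma ex_orthogonal_vector:
  fixes S :: "(real^'k) set"
  assumes "finite S" "card S < CARD('k)"
  obtains x where "x \<noteq> 0" "\<And>y. y \<in> S \<Longrightarrow> y \<bullet> x = 0"
proof -
  have "dim (span S) < DIM(real^'k)"
    using dim_le_card'[OF assms(1)] assms(2) by simp
  then obtain x where "x \<noteq> 0" "\<And>y. y \<in> span S \<Longrightarrow> orthogonal x y"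
    using orthogonal_to_subspace_exists[of S] by auto
  then show thesis
    using that by (metis inner_commute orthogonal_def span_base)
qed

text \<open>Compactness gives a maximizer \<open>w\<close> of the quadratic form on the unit sphere
  of \<open>S\<close>. The part \<open>z\<close> of \<open>M *v w\<close> orthogonal to
  \<open>w\<close> lies in \<open>S\<close>; a small move from \<open>w\<close> towards
  \<open>z\<close> would raise the Rayleigh quotient to first order, so \<open>z\<close>
  vanishes.\<close>

lemma rayleigh_maximizer:
  fixes M :: "real^'k^'k"
  assumes sym: "transpose M = M" and S: "subspace S" and nontriv: "y \<in> S" "y \<noteq> 0"
    and inv: "\<And>x. x \<in> S \<Longrightarrow> M *v x \<in> S"
  obtains w m where "w \<in> S" "w \<bullet> w = 1" "M *v w = m *\<^sub>R w"
    "\<And>x. x \<in> S \<Longrightarrow> x \<bullet> (M *v x) \<le> m * (x \<bullet> x)"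
proof -
  let ?C = "S \<inter> sphere 0 1"
  have "compact ?C"
    by (simp add: S closed_subspace compact_Int_closed Int_commute closed_Int_compact)
  moreover have "(1 / norm y) *\<^sub>R y \<in> ?C"
    using S nontriv by (simp add: subspace_mul)
  moreover have "continuous_on ?C (\<lambda>x. x \<bullet> (M *v x))"
    by (intro continuous_intros linear_continuous_on linear_conv_bounded_linear[THEN iffD1]) simp
  ultimately obtain w where w: "w \<in> ?C" and
      wmax: "\<And>x. x \<in> ?C \<Longrightarrow> x \<bullet> (M *v x) \<le> w \<bullet> (M *v w)"
    using continuous_attains_sup[of ?C "\<lambda>x. x \<bullet> (M *v x)"] by blast
  define m where "m = w \<bullet> (M *v w)"
  have ww: "w \<bullet> w = 1" and wS: "w \<in> S"
    using w by (auto simp: dot_square_norm)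
  have bound: "x \<bullet> (M *v x) \<le> m * (x \<bullet> x)" if "x \<in> S" for x
  proof (cases "x = 0")
    case False
    have "(1 / norm x) *\<^sub>R x \<in> ?C"
      using S that False by (simp add: subspace_mul)
    from wmax[OF this] have "(x \<bullet> (M *v x)) / (norm x)\<^sup>2 \<le> m"
      by (simp add: m_def matrix_vector_mult_scaleR power2_eq_square)
    then show ?thesis
      using False by (simp add: divide_le_eq dot_square_norm)
  qed simp
  define z where "z = M *v w - m *\<^sub>R w"
  have zS: "z \<in> S"
    using S wS inv by (simp add: z_def subspace_diff subspace_mul)
  have wz: "w \<bullet> z = 0"
    by (simp add: z_def inner_diff_right m_def ww)
  have zMw: "z \<bullet> (M *v w) = z \<bullet> z"
    using wz by (simp add: z_def inner_diff_right inner_commute)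
  have wMz: "w \<bullet> (M *v z) = z \<bullet> z"
    using zMw inner_symmetric_matrix[OF sym] by metis
  define c where "c = m * (z \<bullet> z) - z \<bullet> (M *v z)"
  have c0: "c \<ge> 0" using bound[OF zS] by (simp add: c_def)
  \<comment> \<open>The step length makes the second order loss \<open>t\<^sup>2 * c\<close> at most
    half of the first order gain \<open>2 * t * (z \<bullet> z)\<close>. Adding 1 to
    \<open>c\<close> keeps the denominator positive.\<close>
  define t where "t = (z \<bullet> z) / (c + 1)"
  have t0: "t \<ge> 0" using c0 by (simp add: t_def)
  have "w + t *\<^sub>R z \<in> S"
    using S wS zS by (simp add: subspace_add subspace_mul)
  from bound[OF this]
  have "m + 2 * t * (z \<bullet> z) + t\<^sup>2 * (z \<bullet> (M *v z)) \<le> m * (1 + t\<^sup>2 * (z \<bullet> z))"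
    using wz wMz zMw ww
    by (simp add: matrix_vector_right_distrib matrix_vector_mult_scaleR inner_add_left inner_add_right
        m_def[symmetric] inner_commute[of z w] power2_eq_square algebra_simps)
  then have "2 * t * (z \<bullet> z) \<le> t\<^sup>2 * c"
    by (simp add: c_def algebra_simps)
  moreover have "t\<^sup>2 * c \<le> t * (z \<bullet> z)"
  proof -
    have "t * c \<le> z \<bullet> z"
      using c0 by (simp add: t_def divide_simps algebra_simps)
    then show ?thesis
      using mult_left_mono[OF _ t0, of "t * c" "z \<bullet> z"] by (simp add: power2_eq_square ac_simps)
  qed
  ultimately have "t * (z \<bullet> z) \<le> 0" by simp
  then have "(z \<bullet> z) * (z \<bullet> z) \<le> 0"
    using c0 by (simp add: t_def divide_le_0_iff)
  then have "z \<bullet> z = 0"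
    by (metis mult_le_0_iff inner_ge_zero order_antisym)
  then have "M *v w = m *\<^sub>R w"
    by (simp add: z_def)
  then show thesis
    using that wS ww bound by blast
qed

text \<open>Each new eigenvector maximizes the form on the orthogonal complement of the earlier
  ones, which is invariant because \<open>M\<close> is symmetric. The third conjunct records this
  maximality; it is what orders the eigenvalues.\<close>

lemma ex_partial_eigenbasis:
  fixes M :: "real^'k^'k"
  assumes sym: "transpose M = M"
  shows "k \<le> CARD('k) \<Longrightarrow> \<exists>u l.
    (\<forall>i<k. \<forall>j<k. u i \<bullet> u j = (if i = j then 1 else 0)) \<and>
    (\<forall>j<k. M *v u j = l j *\<^sub>R u j) \<and>
    (\<forall>j<k. \<forall>x. (\<forall>i<j. u i \<bullet> x = 0) \<longrightarrow> x \<bullet> (M *v x) \<le> l j * (x \<bullet> x))"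
proof (induction k)
  case (Suc k)
  from Suc.IH[OF Suc_leD[OF Suc.prems]] obtain u l where ul:
    "\<forall>i<k. \<forall>j<k. u i \<bullet> u j = (if i = j then 1 else 0)"
    "\<forall>j<k. M *v u j = l j *\<^sub>R u j"
    "\<forall>j<k. \<forall>x. (\<forall>i<j. u i \<bullet> x = 0) \<longrightarrow> x \<bullet> (M *v x) \<le> l j * (x \<bullet> x)"
    by (elim exE conjE)
  note on = ul(1)[rule_format] and ev = ul(2)[rule_format] and mx = ul(3)[rule_format]
  define S where "S = {x. \<forall>i<k. u i \<bullet> x = 0}"
  have "finite (u ` {..<k})" "card (u ` {..<k}) < CARD('k)"
    using Suc.prems card_image_le[of "{..<k}" u] by auto
  then obtain y where "y \<noteq> 0" and y: "\<And>z. z \<in> u ` {..<k} \<Longrightarrow> z \<bullet> y = 0"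
    by (rule ex_orthogonal_vector) blast
  note \<open>y \<noteq> 0\<close>
  moreover have "y \<in> S"
    using y by (simp add: S_def)
  moreover have "subspace S"
    by (auto simp: S_def subspace_def inner_add_right)
  moreover have "M *v x \<in> S" if "x \<in> S" for x
    using that ev by (simp add: S_def inner_symmetric_matrix[OF sym, of _ x] inner_commute[of x])
  ultimately obtain w m where w: "w \<in> S" "w \<bullet> w = 1" "M *v w = m *\<^sub>R w"
      "\<And>x. x \<in> S \<Longrightarrow> x \<bullet> (M *v x) \<le> m * (x \<bullet> x)"
    using rayleigh_maximizer[OF sym] by metis
  have uw: "u i \<bullet> w = 0" "w \<bullet> u i = 0" if "i < k" for i
    using w(1) that by (auto simp: S_def inner_commute)
  show ?case
  proof (intro exI[of _ "u(k := w)"] exI[of _ "l(k := m)"] conjI allI impI)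
    fix i j assume "i < Suc k" "j < Suc k"
    then show "(u(k := w)) i \<bullet> (u(k := w)) j = (if i = j then 1 else 0)"
      using on[of i j] uw w(2) by (auto simp: less_Suc_eq)
  next
    fix j assume "j < Suc k"
    then show "M *v (u(k := w)) j = (l(k := m)) j *\<^sub>R (u(k := w)) j"
      using ev w(3) by (auto simp: less_Suc_eq)
  next
    fix j x assume j: "j < Suc k" and orth: "\<forall>i<j. (u(k := w)) i \<bullet> x = 0"
    have orth': "u i \<bullet> x = 0" if "i < j" for i
      using orth[rule_format, OF that] that j by (simp split: if_splits)
    show "x \<bullet> (M *v x) \<le> (l(k := m)) j * (x \<bullet> x)"
    proof (cases "j = k")
      case True
      then show ?thesis using w(4)[of x] orth' by (simp add: S_def)
    next
      case False
      then show ?thesis using mx[of j x] j orth' by simp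
    qed
  qed
qed simp

theorem ex_ordered_eigenbasis:
  fixes M :: "real^'k^'k"
  assumes sym: "transpose M = M"
  obtains u l where "eigenbasis M u l" "\<And>i j. i \<le> j \<Longrightarrow> j < CARD('k) \<Longrightarrow> l j \<le> l i"
proof -
  from ex_partial_eigenbasis[OF sym order_refl] obtain u l where ul:
    "\<forall>i<CARD('k). \<forall>j<CARD('k). u i \<bullet> u j = (if i = j then 1 else 0)"
    "\<forall>j<CARD('k). M *v u j = l j *\<^sub>R u j"
    "\<forall>j<CARD('k). \<forall>x. (\<forall>i<j. u i \<bullet> x = 0) \<longrightarrow> x \<bullet> (M *v x) \<le> l j * (x \<bullet> x)"
    by (elim exE conjE)
  note on = ul(1)[rule_format] and ev = ul(2)[rule_format] and mx = ul(3)[rule_format]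
  \<comment> \<open>For i \<le> j the unit vector \<open>u j\<close> is orthogonal to the first
    \<open>i\<close> eigenvectors, so it competes in the maximization that produced
    \<open>l i\<close>.\<close>
  have "l j \<le> l i" if "i \<le> j" "j < CARD('k)" for i j
    using mx[of i "u j"] on[of _ j] ev[of j] that by simp
  moreover have "eigenbasis M u l"
    using on ev by (simp add: eigenbasis_def orthonormal_seq_def)
  ultimately show thesis by (rule that[rotated])
qed

section \<open>Expansion, determinant and trace in an eigenbasis\<close>

lemma orthonormal_seq_expand:
  fixes u :: "nat \<Rightarrow> real^'k"
  assumes "orthonormal_seq u"
  shows "x = (\<Sum>j<CARD('k). (u j \<bullet> x) *\<^sub>R u j)"
proof -
  define y where "y = x - (\<Sum>j<CARD('k). (u j \<bullet> x) *\<^sub>R u j)"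
  have on: "u i \<bullet> u j = (if i = j then 1 else 0)" if "i < CARD('k)" "j < CARD('k)" for i j
    using assms that by (simp add: orthonormal_seq_def)
  have "u i \<bullet> (\<Sum>j<CARD('k). (u j \<bullet> x) *\<^sub>R u j) = (\<Sum>j<CARD('k). if i = j then u j \<bullet> x else 0)"
    if "i < CARD('k)" for i
    unfolding inner_sum_right by (rule sum.cong) (use on that in auto)
  then have uy: "u i \<bullet> y = 0" if "i < CARD('k)" for i
    using that by (simp add: y_def inner_diff_right sum.delta)
  let ?B = "u ` {..<CARD('k)}"
  have inj: "inj_on u {..<CARD('k)}"
    by (rule inj_onI) (metis on lessThan_iff zero_neq_one)
  have "pairwise orthogonal ?B"
    unfolding pairwise_def orthogonal_def using on by auto
  moreover have "0 \<notin> ?B"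
    using on by fastforce
  ultimately have "independent ?B"
    by (rule pairwise_orthogonal_independent)
  moreover have "card ?B = DIM(real^'k)"
    using inj by (simp add: card_image)
  \<comment> \<open>As many independent vectors as the dimension span the space, so the remainder
    \<open>y\<close>, orthogonal to all of them, is orthogonal to itself.\<close>
  ultimately have "span ?B = UNIV"
    by (metis card_ge_dim_independent dim_UNIV order_refl subset_UNIV top.extremum_uniqueI)
  then have "orthogonal y y"
    using uy by (intro orthogonal_to_span[of y ?B]) (auto simp: orthogonal_def inner_commute)
  then show ?thesis
    by (simp add: orthogonal_def y_def)
qed

lemma orthonormal_seq_matrix_eqI:
  fixes M M' :: "real^'k^'m" and u :: "nat \<Rightarrow> real^'k"
  assumes "orthonormal_seq u" "\<And>j. j < CARD('k) \<Longrightarrow> M *v u j = M' *v u j"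
  shows "M = M'"
proof -
  have "M *v x = M' *v x" for x
    using assms(2)
    by (subst (1 2) orthonormal_seq_expand[OF assms(1), of x])
      (simp add: linear_sum[OF matrix_vector_mul_linear] matrix_vector_mult_scaleR)
  then show ?thesis by (simp add: matrix_eq)
qed

text \<open>Passes from natural number indices to the index type \<open>'k\<close>: \<open>h\<close>
  is an arbitrary numbering of \<open>'k\<close>, and the eigenvectors become the columns of
  \<open>Q\<close> in that numbering.\<close>

lemma eigenbasis_diagonalize:
  fixes M :: "real^'k^'k"
  assumes "eigenbasis M u l"
  obtains Q D h where "orthogonal_matrix Q" "M = Q ** D ** transpose Q"
    "bij_betw h UNIV {..<CARD('k)}" "D = (\<chi> i j. if i = j then l (h i) else 0)"
proof -
  have on: "orthonormal_seq u" and ev: "\<And>j. j < CARD('k) \<Longrightarrow> M *v u j = l j *\<^sub>R u j"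
    using assms by (auto simp: eigenbasis_def)
  obtain h :: "'k \<Rightarrow> nat" where h: "bij_betw h UNIV {..<CARD('k)}"
    using ex_bij_betw_finite_nat[of "UNIV :: 'k set"] by (auto simp: lessThan_atLeast0)
  have hlt: "h i < CARD('k)" for i
    using h by (auto simp: bij_betw_def)
  have hinj: "h i = h j \<longleftrightarrow> i = j" for i j
    using h by (auto simp: bij_betw_def inj_on_def)
  define Q where "Q = (\<chi> i k. u (h k) $ i)"
  define D :: "real^'k^'k" where "D = (\<chi> i j. if i = j then l (h i) else 0)"
  have col: "column k Q = u (h k)" for k
    by (simp add: Q_def column_def)
  have orth: "orthogonal_matrix Q"
    using on hlt hinj
    by (simp add: orthogonal_matrix matrix_mult_transpose_dot_column col mat_def orthonormal_seq_def)
  have "(M ** Q) $ i $ j = (Q ** D) $ i $ j" for i j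
  proof -
    have "(M ** Q) $ i $ j = (M *v u (h j)) $ i"
      by (simp add: matrix_matrix_mult_def matrix_vector_mult_def Q_def)
    also have "\<dots> = l (h j) * u (h j) $ i"
      by (simp add: ev hlt)
    also have "\<dots> = (Q ** D) $ i $ j"
      by (simp add: matrix_matrix_mult_def Q_def D_def if_distrib cong: if_cong)
    finally show ?thesis .
  qed
  then have "M ** Q = Q ** D" by (simp add: vec_eq_iff)
  moreover have "Q ** transpose Q = mat 1"
    using orth by (simp add: orthogonal_matrix_def)
  ultimately have "M = Q ** D ** transpose Q"
    by (metis matrix_mul_assoc matrix_mul_rid)
  then show thesis
    using that orth h D_def by blast
qed

lemma eigenbasis_det:
  fixes M :: "real^'k^'k"
  assumes "eigenbasis M u l"
  shows "det M = (\<Prod>j<CARD('k). l j)"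
proof -
  obtain Q D h where Q: "orthogonal_matrix Q" and M: "M = Q ** D ** transpose Q"
    and h: "bij_betw h UNIV {..<CARD('k)}" and D: "D = (\<chi> i j. if i = j then l (h i) else 0)"
    using eigenbasis_diagonalize[OF assms] .
  have "det D = (\<Prod>i\<in>UNIV. l (h i))"
    by (subst det_diagonal) (auto simp: D)
  also have "\<dots> = (\<Prod>j<CARD('k). l j)"
    by (rule prod.reindex_bij_betw[OF h])
  finally have "det D = \<dots>" .
  moreover have "det M = det D * (det Q * det Q)"
    by (simp add: M det_mul)
  moreover have "det Q * det Q = 1"
    using det_orthogonal_matrix[OF Q] by auto
  ultimately show ?thesis by simp
qed

lemma eigenbasis_trace:
  fixes M :: "real^'k^'k"
  assumes "eigenbasis M u l"
  shows "trace M = (\<Sum>j<CARD('k). l j)"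
proof -
  obtain Q D h where Q: "orthogonal_matrix Q" and M: "M = Q ** D ** transpose Q"
    and h: "bij_betw h UNIV {..<CARD('k)}" and D: "D = (\<chi> i j. if i = j then l (h i) else 0)"
    using eigenbasis_diagonalize[OF assms] .
  have "trace M = trace (transpose Q ** Q ** D)"
    unfolding M by (subst trace_mul_sym) (simp add: matrix_mul_assoc)
  also have "\<dots> = (\<Sum>i\<in>UNIV. l (h i))"
    using Q by (simp add: orthogonal_matrix trace_def D)
  also have "\<dots> = (\<Sum>j<CARD('k). l j)"
    by (rule sum.reindex_bij_betw[OF h])
  finally show ?thesis .
qed

lemma eigenbasis_inner:
  fixes M :: "real^'k^'k"
  assumes "eigenbasis M u l"
  shows "x \<bullet> (M *v x) = (\<Sum>j<CARD('k). l j * (u j \<bullet> x)\<^sup>2)"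
proof -
  have on: "orthonormal_seq u" and ev: "\<And>j. j < CARD('k) \<Longrightarrow> M *v u j = l j *\<^sub>R u j"
    using assms by (auto simp: eigenbasis_def)
  have "M *v x = (\<Sum>j<CARD('k). (u j \<bullet> x) *\<^sub>R (l j *\<^sub>R u j))"
    by (subst orthonormal_seq_expand[OF on, of x])
      (simp add: linear_sum[OF matrix_vector_mul_linear] matrix_vector_mult_scaleR ev)
  then show ?thesis
    by (simp add: inner_sum_right inner_commute[of x] power2_eq_square ac_simps)
qed

text \<open>Together with \<open>eigenbasis_inner\<close> this yields Parseval's identity.\<close>

lemma eigenbasis_mat_1:
  "orthonormal_seq u \<Longrightarrow> eigenbasis (mat 1) u (\<lambda>_. 1)"
  by (simp add: eigenbasis_def)

lemma eigenbasis_eigenvalue: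
  fixes M :: "real^'k^'k"
  assumes "eigenbasis M u l" "j < CARD('k)"
  shows "u j \<bullet> (M *v u j) = l j" "u j \<noteq> 0"
  using assms by (auto simp: eigenbasis_def orthonormal_seq_def dest!: spec[of _ j])

text \<open>The sum of the rank one matrices \<open>l j * u j * transpose (u j)\<close>, written
  entrywise.\<close>

definition spectral_matrix :: "(nat \<Rightarrow> real^'k) \<Rightarrow> (nat \<Rightarrow> real) \<Rightarrow> real^'k^'k" where
  "spectral_matrix u l = (\<chi> i k. \<Sum>j<CARD('k). l j * (u j $ i * u j $ k))"

lemma transpose_spectral_matrix: "transpose (spectral_matrix u l) = spectral_matrix u l"
  by (simp add: spectral_matrix_def transpose_def vec_eq_iff ac_simps)

lemma spectral_matrix_mult_vector:
  fixes u :: "nat \<Rightarrow> real^'k"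
  shows "spectral_matrix u l *v x = (\<Sum>j<CARD('k). (l j * (u j \<bullet> x)) *\<^sub>R u j)"
proof -
  have "(spectral_matrix u l *v x) $ i = (\<Sum>j<CARD('k). (l j * (u j \<bullet> x)) *\<^sub>R u j) $ i" for i
    unfolding spectral_matrix_def matrix_vector_mult_def
    by (simp add: sum_distrib_right sum_distrib_left inner_vec_def ac_simps)
      (subst sum.swap, rule refl)
  then show ?thesis by (simp add: vec_eq_iff)
qed

lemma eigenbasis_spectral_matrix:
  assumes "orthonormal_seq u"
  shows "eigenbasis (spectral_matrix u l) u l"
proof -
  have "spectral_matrix u l *v u i = l i *\<^sub>R u i" if "i < CARD('a)" for i
  proof -
    have "spectral_matrix u l *v u i = (\<Sum>j<CARD('a). if j = i then l i *\<^sub>R u i else 0)"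
      unfolding spectral_matrix_mult_vector
      by (rule sum.cong) (use assms that in \<open>auto simp: orthonormal_seq_def\<close>)
    then show ?thesis using that by simp
  qed
  then show ?thesis using assms by (simp add: eigenbasis_def)
qed

section \<open>Positive definite matrices\<close>

definition pos_semidef :: "real^'k^'k \<Rightarrow> bool" where
  "pos_semidef M \<longleftrightarrow> transpose M = M \<and> (\<forall>x. 0 \<le> x \<bullet> (M *v x))"

lemma pos_def_imp_pos_semidef: "pos_def M \<Longrightarrow> pos_semidef M"
  unfolding pos_def_def pos_semidef_def by (metis inner_zero_left less_imp_le order_refl)

lemma pos_def_eigenvalue_pos:
  fixes M :: "real^'k^'k"
  assumes "pos_def M" "eigenbasis M u l" "j < CARD('k)"
  shows "0 < l j"
  using assms eigenbasis_eigenvalue[OF assms(2,3)] by (metis pos_def_def)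

lemma pos_semidef_eigenvalue_nonneg:
  fixes M :: "real^'k^'k"
  assumes "pos_semidef M" "eigenbasis M u l" "j < CARD('k)"
  shows "0 \<le> l j"
  using assms eigenbasis_eigenvalue[OF assms(2,3)] by (metis pos_semidef_def)

lemma pos_def_eigenbasisI:
  fixes M :: "real^'k^'k"
  assumes "transpose M = M" and e: "eigenbasis M u l" and pos: "\<And>j. j < CARD('k) \<Longrightarrow> 0 < l j"
  shows "pos_def M"
  unfolding pos_def_def
proof (intro conjI allI impI)
  fix x :: "real^'k" assume "x \<noteq> 0"
  have on: "orthonormal_seq u" using e by (simp add: eigenbasis_def)
  \<comment> \<open>One nonvanishing coordinate suffices to make the sum of nonnegative terms
    strictly positive.\<close>
  have "\<exists>j<CARD('k). u j \<bullet> x \<noteq> 0"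
    using orthonormal_seq_expand[OF on, of x] \<open>x \<noteq> 0\<close> by (metis (no_types, lifting) lessThan_iff scaleR_zero_left sum.neutral)
  then obtain j where j: "j < CARD('k)" "u j \<bullet> x \<noteq> 0" by blast
  show "0 < x \<bullet> (M *v x)"
    unfolding eigenbasis_inner[OF e]
    by (rule sum_pos2[of _ j]) (use j pos in \<open>auto intro!: mult_nonneg_nonneg simp: less_imp_le\<close>)
qed fact

lemma pos_def_det_pos:
  assumes "pos_def M"
  shows "0 < det M"
proof -
  obtain u l where e: "eigenbasis M u l"
    using ex_ordered_eigenbasis assms unfolding pos_def_def by metis
  then show ?thesis
    using pos_def_eigenvalue_pos[OF assms e] by (auto simp: eigenbasis_det[OF e] intro: prod_pos)
qed

lemma pos_def_invertible: "pos_def M \<Longrightarrow> invertible M"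
  using pos_def_det_pos[of M] by (simp add: invertible_det_nz)

text \<open>The determinant is the product of the eigenvalues, so invertibility excludes the
  eigenvalue 0.\<close>

lemma pos_semidef_invertible_imp_pos_def:
  fixes M :: "real^'k^'k"
  assumes M: "pos_semidef M" and "invertible M"
  shows "pos_def M"
proof -
  have sym: "transpose M = M" using M by (simp add: pos_semidef_def)
  obtain u l where e: "eigenbasis M u l"
    using ex_ordered_eigenbasis[OF sym] by metis
  have "(\<Prod>j<CARD('k). l j) \<noteq> 0"
    using assms(2) by (simp add: invertible_det_nz eigenbasis_det[OF e])
  then have "l j \<noteq> 0" if "j < CARD('k)" for j
    using that by (auto simp: prod_zero_iff)
  then show ?thesis
    using pos_def_eigenbasisI[OF sym e] pos_semidef_eigenvalue_nonneg[OF M e] by (metis order_less_le)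
qed

lemma pos_semidef_gram: "pos_semidef (transpose A ** A)" for A :: "real^'k^'m"
  by (simp add: pos_semidef_def matrix_transpose_mul matrix_vector_mul_assoc[symmetric]
      inner_matrix_transpose[of _ "transpose A"])

lemma pos_semidef_gram': "pos_semidef (A ** transpose A)" for A :: "real^'k^'m"
  using pos_semidef_gram[of "transpose A"] by simp

lemma pos_semidef_scaleR: "pos_semidef M \<Longrightarrow> 0 \<le> c \<Longrightarrow> pos_semidef (c *\<^sub>R M)"
  by (simp add: pos_semidef_def transpose_scalar scaleR_matrix_vector_assoc[symmetric])

lemma pos_def_add_pos_semidef: "pos_def M \<Longrightarrow> pos_semidef N \<Longrightarrow> pos_def (M + N)"
  by (simp add: pos_def_def pos_semidef_def transpose_add matrix_vector_mult_add_rdistrib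
      inner_add_right add_pos_nonneg)

lemma pos_def_mat_1: "pos_def (mat 1)"
  by (simp add: pos_def_def)

section \<open>Inverses and congruences\<close>

lemma matrix_inv_works:
  fixes M :: "real^'k^'k"
  assumes "invertible M"
  shows "M ** matrix_inv M = mat 1" "matrix_inv M ** M = mat 1"
  using someI_ex[OF assms[unfolded invertible_def]] by (auto simp: matrix_inv_def)

lemma matrix_inv_unique:
  fixes M N :: "real^'k^'k"
  assumes "M ** N = mat 1"
  shows "matrix_inv M = N"
proof -
  have "invertible M" using assms by (auto simp: invertible_right_inverse)
  then show ?thesis
    by (metis assms matrix_inv_works(2) matrix_mul_assoc matrix_mul_lid matrix_mul_rid)
qed

lemma transpose_matrix_inv:
  fixes M :: "real^'k^'k"
  assumes "invertible M"
  shows "transpose (matrix_inv M) = matrix_inv (transpose M)"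
  by (rule matrix_inv_unique[symmetric])
    (metis assms matrix_inv_works(2) matrix_transpose_mul transpose_mat)

lemma det_matrix_inv:
  fixes M :: "real^'k^'k"
  assumes "invertible M"
  shows "det (matrix_inv M) = inverse (det M)"
  by (metis assms det_I det_mul inverse_unique matrix_inv_works(1))

lemma invertible_matrix_inv: "invertible M \<Longrightarrow> invertible (matrix_inv M)" for M :: "real^'k^'k"
  using matrix_inv_works[of M] by (auto simp: invertible_def)

lemma pos_def_congruence:
  fixes M T :: "real^'k^'k"
  assumes M: "pos_def M" and T: "invertible T"
  shows "pos_def (transpose T ** M ** T)"
proof -
  have "T *v x \<noteq> 0" if "x \<noteq> 0" for x
    using that T by (metis matrix_inv_works(2) matrix_vector_mul_assoc matrix_vector_mul_lid
        matrix_vector_mult_0_right)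
  moreover have "x \<bullet> ((transpose T ** M ** T) *v x) = (T *v x) \<bullet> (M *v (T *v x))" for x
    by (simp add: matrix_vector_mul_assoc[symmetric] inner_matrix_transpose[of _ "transpose T"])
  ultimately show ?thesis
    using M by (simp add: pos_def_def matrix_transpose_mul matrix_mul_assoc)
qed

lemma pos_def_matrix_inv:
  fixes M :: "real^'k^'k"
  assumes M: "pos_def M"
  shows "pos_def (matrix_inv M)"
proof -
  have inv: "invertible M" using M by (rule pos_def_invertible)
  have sym: "transpose (matrix_inv M) = matrix_inv M"
    using M by (simp add: transpose_matrix_inv[OF inv] pos_def_def)
  \<comment> \<open>The inverse is congruent to \<open>M\<close>, with itself as the transforming
    matrix.\<close>
  have "transpose (matrix_inv M) ** M ** matrix_inv M = matrix_inv M"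
    by (simp add: sym matrix_inv_works[OF inv])
  then show ?thesis
    using pos_def_congruence[OF M invertible_matrix_inv[OF inv]] by simp
qed

section \<open>Symmetric square roots\<close>

lemma pos_def_sqrt_exists:
  assumes M: "pos_def M"
  shows "\<exists>R. pos_def R \<and> R ** R = M"
proof -
  obtain u l where e: "eigenbasis M u l"
    using ex_ordered_eigenbasis M unfolding pos_def_def by metis
  then have on: "orthonormal_seq u" by (simp add: eigenbasis_def)
  let ?R = "spectral_matrix u (\<lambda>j. sqrt (l j))"
  have R: "eigenbasis ?R u (\<lambda>j. sqrt (l j))"
    by (rule eigenbasis_spectral_matrix[OF on])
  have "pos_def ?R"
    by (rule pos_def_eigenbasisI[OF transpose_spectral_matrix R])
      (simp add: pos_def_eigenvalue_pos[OF M e])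
  moreover have "?R ** ?R = M"
    by (rule orthonormal_seq_matrix_eqI[OF on])
      (use e R pos_def_eigenvalue_pos[OF M e] in \<open>auto simp: eigenbasis_def matrix_vector_mult_scaleR
        matrix_vector_mul_assoc[symmetric] less_imp_le\<close>)
  ultimately show ?thesis by blast
qed

text \<open>If \<open>u\<close> is an eigenvector of \<open>R\<close> with eigenvalue
  \<open>l\<close>, then (R' + l)(R' - l) annihilates \<open>u\<close>, because R' and
  \<open>R\<close> have the same square. The first factor is positive definite, so R' acts on
  \<open>u\<close> as \<open>R\<close> does.\<close>

lemma pos_def_sqrt_unique:
  fixes R R' :: "real^'k^'k"
  assumes R: "pos_def R" and R': "pos_def R'" and eq: "R ** R = R' ** R'"
  shows "R = R'"
proof -
  obtain u l where e: "eigenbasis R u l"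
    using ex_ordered_eigenbasis R unfolding pos_def_def by metis
  have "R *v u j = R' *v u j" if j: "j < CARD('k)" for j
  proof -
    have Ru: "R *v u j = l j *\<^sub>R u j"
      using e j by (simp add: eigenbasis_def)
    define z where "z = R' *v u j - l j *\<^sub>R u j"
    have "R' *v z + l j *\<^sub>R z = (R' ** R') *v u j - (R ** R) *v u j"
      by (simp add: z_def Ru matrix_vector_mult_diff_distrib matrix_vector_mult_scaleR
          matrix_vector_mul_assoc[symmetric] algebra_simps)
    then have "z \<bullet> (R' *v z) + l j * (z \<bullet> z) = 0"
      by (metis eq diff_self inner_add_right inner_scaleR_right inner_zero_right)
    moreover have "0 \<le> l j * (z \<bullet> z)"
      using pos_def_eigenvalue_pos[OF R e j] by simp
    ultimately have "\<not> 0 < z \<bullet> (R' *v z)" by linarith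
    then have "z = 0"
      using R' by (auto simp: pos_def_def)
    then show ?thesis by (simp add: z_def Ru)
  qed
  then show ?thesis
    using e by (auto simp: eigenbasis_def intro: orthonormal_seq_matrix_eqI)
qed

lemma msqrt_works:
  assumes "pos_def M"
  shows "pos_def (msqrt M)" "msqrt M ** msqrt M = M"
proof -
  have "\<exists>!R. pos_def R \<and> R ** R = M"
    using pos_def_sqrt_exists[OF assms] pos_def_sqrt_unique by metis
  from theI'[OF this] show "pos_def (msqrt M)" "msqrt M ** msqrt M = M"
    by (auto simp: msqrt_def)
qed

text \<open>With \<open>T\<^sup>2 = \<Delta>\<^sup>-\<^sup>1\<close> the inequality reads \<open>ln x \<le> x - 1\<close> for the eigenvalues of \<open>T S T\<close>.\<close>
lemma gaussian_loglik_bound: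
  fixes \<Delta> S :: "real^'k^'k"
  assumes \<Delta>: "pos_def \<Delta>" and S: "pos_def S"
  shows "real CARD('k) + ln (det S) \<le> ln (det \<Delta>) + trace (matrix_inv \<Delta> ** S)"
proof -
  note inv = pos_def_matrix_inv[OF \<Delta>]
  define T where "T = msqrt (matrix_inv \<Delta>)"
  have T: "pos_def T" "T ** T = matrix_inv \<Delta>"
    using msqrt_works[OF inv] by (auto simp: T_def)
  have symT: "transpose T = T" using T by (simp add: pos_def_def)
  \<comment> \<open>\<open>M\<close> is similar to \<open>matrix_inv \<Delta> ** S\<close>, hence
    has the same trace and determinant, but is symmetric and so has an eigenbasis.\<close>
  define M where "M = T ** S ** T"
  have M: "pos_def M"
    using pos_def_congruence[OF S pos_def_invertible[OF T(1)]] by (simp add: M_def symT)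
  have "trace M = trace (T ** (T ** S))"
    unfolding M_def by (rule trace_mul_sym)
  then have tr: "trace M = trace (matrix_inv \<Delta> ** S)"
    by (simp add: matrix_mul_assoc T)
  have "det M = det (matrix_inv \<Delta>) * det S"
    by (simp add: M_def det_mul T(2)[symmetric])
  then have dt: "ln (det M) = ln (det S) - ln (det \<Delta>)"
    using pos_def_det_pos[OF \<Delta>] pos_def_det_pos[OF S]
    by (simp add: det_matrix_inv[OF pos_def_invertible[OF \<Delta>]] ln_mult ln_inverse)
  obtain u l where e: "eigenbasis M u l"
    using ex_ordered_eigenbasis M unfolding pos_def_def by metis
  have pos: "0 < l j" if "j < CARD('k)" for j
    using pos_def_eigenvalue_pos[OF M e that] .
  have "ln (det M) = (\<Sum>j<CARD('k). ln (l j))"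
    unfolding eigenbasis_det[OF e] by (rule ln_prod) (auto simp: less_imp_neq[OF pos, symmetric] pos)
  also have "\<dots> \<le> (\<Sum>j<CARD('k). l j - 1)"
    by (rule sum_mono) (use pos ln_le_minus_one in auto)
  also have "\<dots> = trace M - CARD('k)"
    by (simp add: sum_subtractf eigenbasis_trace[OF e])
  finally show ?thesis
    by (simp add: tr dt)
qed

section \<open>Kronecker products\<close>

lemma kron_mult: "kron A B ** kron C D = kron (A ** C) (B ** D)"
proof -
  have "(\<Sum>k\<in>UNIV. A $ i $ fst k * B $ a $ snd k * (C $ fst k $ j * D $ snd k $ b)) =
        (\<Sum>k\<in>UNIV. A $ i $ k * C $ k $ j) * (\<Sum>k\<in>UNIV. B $ a $ k * D $ k $ b)" for i a j b
    unfolding sum_product sum.cartesian_product UNIV_Times_UNIV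
    by (rule sum.cong) auto
  then show ?thesis
    by (simp add: kron_def matrix_matrix_mult_def vec_eq_iff)
qed

lemma kron_mat_1: "kron (mat 1) (mat 1) = mat 1"
  by (auto simp: kron_def mat_def vec_eq_iff prod_eq_iff)

lemma transpose_kron: "transpose (kron A B) = kron (transpose A) (transpose B)"
  by (simp add: kron_def transpose_def vec_eq_iff)

lemma kron_mat_1_cancel:
  assumes "kron A (mat 1 :: real^'k^'k) = kron B (mat 1)"
  shows "A = B"
proof -
  have "A $ i $ j = B $ i $ j" for i j
    \<comment> \<open>Any diagonal entry of the second factor equals 1, so \<open>undefined\<close>
      merely names some index.\<close>
    using arg_cong[OF assms, of "\<lambda>M. M $ (i, undefined) $ (j, undefined)"]
    by (simp add: kron_def mat_def)
  then show ?thesis by (simp add: vec_eq_iff)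
qed

lemma matrix_inv_kron:
  fixes K :: "real^'m^'m" and M :: "real^'k^'k"
  assumes "invertible K" "invertible M"
  shows "matrix_inv (kron K M) = kron (matrix_inv K) (matrix_inv M)"
  by (rule matrix_inv_unique) (simp add: kron_mult matrix_inv_works assms kron_mat_1)

text \<open>The Kronecker product of orthogonal matrices is orthogonal, so both factors may be
  diagonalized at once; for diagonal factors the determinant is a product over index pairs. The
  symmetric case is enough for covariance matrices.\<close>

lemma det_kron_symmetric:
  fixes K :: "real^'m^'m" and M :: "real^'k^'k"
  assumes "transpose K = K" "transpose M = M"
  shows "det (kron K M) = det K ^ CARD('k) * det M ^ CARD('m)"
proof -
  obtain u l where "eigenbasis K u l" using ex_ordered_eigenbasis[OF assms(1)] by metis
  then obtain Q D h where Q: "orthogonal_matrix Q" and K: "K = Q ** D ** transpose Q"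
    and D: "D = (\<chi> i j. if i = j then l (h i) else 0)"
    by (rule eigenbasis_diagonalize)
  obtain u' l' where "eigenbasis M u' l'" using ex_ordered_eigenbasis[OF assms(2)] by metis
  then obtain P E h' where P: "orthogonal_matrix P" and M: "M = P ** E ** transpose P"
    and E: "E = (\<chi> i j. if i = j then l' (h' i) else 0)"
    by (rule eigenbasis_diagonalize)
  have orth_det: "det (Z ** Y ** transpose Z) = det Y" if "orthogonal_matrix Z" for Z Y :: "real^'z^'z"
    using det_orthogonal_matrix[OF that] by (auto simp: det_mul)
  have "orthogonal_matrix (kron Q P)"
    using Q P by (simp add: orthogonal_matrix transpose_kron kron_mult kron_mat_1)
  moreover have "kron K M = kron Q P ** kron D E ** transpose (kron Q P)"
    by (simp add: K M transpose_kron kron_mult)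
  ultimately have "det (kron K M) = det (kron D E)"
    by (simp add: orth_det)
  also have "\<dots> = (\<Prod>a\<in>UNIV. l (h (fst a)) * l' (h' (snd a)))"
    by (subst det_diagonal) (auto simp: kron_def D E prod_eq_iff)
  also have "\<dots> = (\<Prod>i\<in>UNIV. \<Prod>j\<in>UNIV. l (h i) * l' (h' j))"
    by (simp add: prod.cartesian_product split_def)
  also have "\<dots> = det D ^ CARD('k) * det E ^ CARD('m)"
  proof -
    have "det D = (\<Prod>i\<in>UNIV. l (h i))" "det E = (\<Prod>j\<in>UNIV. l' (h' j))"
      by (subst det_diagonal; auto simp: D E)+
    then show ?thesis by (simp add: prod.distrib prod_power_distrib)
  qed
  also have "\<dots> = det K ^ CARD('k) * det M ^ CARD('m)"
    by (simp add: K M orth_det[OF Q] orth_det[OF P])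
  finally show ?thesis .
qed

lemma sum_UNIV_prod: "(\<Sum>a\<in>UNIV. g a) = (\<Sum>i\<in>UNIV. \<Sum>j\<in>UNIV. g (i, j))"
  by (simp add: sum.cartesian_product)

text \<open>The usual vectorization rule for a product of three matrices, in the row stacking
  convention.\<close>

lemma kron_mult_vec_rows:
  fixes E :: "real^'k^'m"
  shows "kron K M *v vec_rows E = vec_rows (K ** E ** transpose M)"
proof -
  have "(\<Sum>j\<in>UNIV. \<Sum>b\<in>UNIV. K $ i $ j * M $ a $ b * E $ j $ b) =
      (\<Sum>b\<in>UNIV. (\<Sum>j\<in>UNIV. K $ i $ j * E $ j $ b) * M $ a $ b)" for i a
    by (subst sum.swap) (simp add: sum_distrib_left sum_distrib_right ac_simps)
  then show ?thesis
    by (simp add: kron_def vec_rows_def matrix_vector_mult_def matrix_matrix_mult_def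
        transpose_def vec_eq_iff sum_UNIV_prod)
qed

lemma inner_vec_rows: "vec_rows A \<bullet> vec_rows B = trace (A ** transpose B)"
  by (simp add: vec_rows_def inner_vec_def sum_UNIV_prod trace_def matrix_matrix_mult_def
      transpose_def)

text \<open>Turns the exponent of the normal density into the trace of the log-likelihood.\<close>

lemma inner_vec_rows_kron:
  "vec_rows E \<bullet> (kron K M *v vec_rows E) = trace (E ** M ** transpose E ** transpose K)"
  by (simp add: kron_mult_vec_rows inner_vec_rows matrix_transpose_mul matrix_mul_assoc)

section \<open>Determinants under low-rank perturbation\<close>

lemma eigenbasis_add_mat_1:
  assumes "eigenbasis M u l"
  shows "eigenbasis (mat 1 + M) u (\<lambda>j. 1 + l j)"
  using assms by (simp add: eigenbasis_def matrix_vector_mult_add_rdistrib scaleR_add_left)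

text \<open>The bound is required only for indices that occur in \<open>x\<close>, so this is the
  Rayleigh bound on the span of a selection of eigenvectors.\<close>

lemma eigenbasis_inner_ge:
  fixes M :: "real^'k^'k"
  assumes e: "eigenbasis M u l" and c: "\<And>j. j < CARD('k) \<Longrightarrow> u j \<bullet> x \<noteq> 0 \<Longrightarrow> c \<le> l j"
  shows "c * (x \<bullet> x) \<le> x \<bullet> (M *v x)"
proof -
  have on: "orthonormal_seq u" using e by (simp add: eigenbasis_def)
  have "x \<bullet> x = (\<Sum>j<CARD('k). (u j \<bullet> x)\<^sup>2)"
    using eigenbasis_inner[OF eigenbasis_mat_1[OF on], of x] by simp
  then show ?thesis
    unfolding eigenbasis_inner[OF e]
    by (simp add: sum_distrib_left, intro sum_mono) (use c in \<open>force intro: mult_right_mono\<close>)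
qed

lemma eigenbasis_inner_le:
  fixes M :: "real^'k^'k"
  assumes e: "eigenbasis M u l" and c: "\<And>j. j < CARD('k) \<Longrightarrow> u j \<bullet> x \<noteq> 0 \<Longrightarrow> l j \<le> c"
  shows "x \<bullet> (M *v x) \<le> c * (x \<bullet> x)"
proof -
  have on: "orthonormal_seq u" using e by (simp add: eigenbasis_def)
  have "x \<bullet> x = (\<Sum>j<CARD('k). (u j \<bullet> x)\<^sup>2)"
    using eigenbasis_inner[OF eigenbasis_mat_1[OF on], of x] by simp
  then show ?thesis
    unfolding eigenbasis_inner[OF e]
    by (simp add: sum_distrib_left, intro sum_mono) (use c in \<open>force intro: mult_right_mono\<close>)
qed

text \<open>A dimension count yields a nonzero vector in the kernel of \<open>A\<^sup>T\<close> that is orthogonal both to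
  the first \<open>j\<close> vectors \<open>u\<close> and to all \<open>v i\<close> with \<open>i > j + d\<close>.\<close>
lemma weyl_low_rank:
  fixes M M' :: "real^'p^'p" and A :: "real^'d^'p"
  assumes e: "eigenbasis M v l" and ord: "\<And>i j. i \<le> j \<Longrightarrow> j < CARD('p) \<Longrightarrow> l j \<le> l i"
    and e': "eigenbasis M' u m" and ord': "\<And>i j. i \<le> j \<Longrightarrow> j < CARD('p) \<Longrightarrow> m j \<le> m i"
    and agree: "\<And>x. transpose A *v x = 0 \<Longrightarrow> x \<bullet> (M' *v x) = x \<bullet> (M *v x)"
    and j: "j + CARD('d) < CARD('p)"
  shows "l (j + CARD('d)) \<le> m j"
proof -
  let ?d = "CARD('d)" and ?p = "CARD('p)"
  let ?S = "range (\<lambda>k. column k A) \<union> u ` {..<j} \<union> v ` {j + ?d<..<?p}"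
  have "card (range (\<lambda>k. column k A)) \<le> ?d"
    by (rule card_image_le) simp
  moreover have "card (u ` {..<j}) \<le> j"
    using card_image_le[of "{..<j}" u] by simp
  moreover have "card (v ` {j + ?d<..<?p}) \<le> ?p - Suc (j + ?d)"
    using card_image_le[of "{j + ?d<..<?p}" v] by simp
  \<comment> \<open>The three families contribute at most d, j and p - j - d - 1 vectors, together p
    - 1: just one short of the dimension.\<close>
  ultimately have "card ?S \<le> ?d + j + (?p - Suc (j + ?d))"
    by (meson add_mono card_Un_le order_trans)
  also have "\<dots> < ?p" using j by simp
  finally have "card ?S < ?p" .
  then obtain x where "x \<noteq> 0" and x: "\<And>y. y \<in> ?S \<Longrightarrow> y \<bullet> x = 0"
    by (rule ex_orthogonal_vector[rotated]) auto
  have "column k A \<bullet> x = 0" for k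
    by (rule x) simp
  then have "transpose A *v x = 0"
    by (simp add: vec_eq_iff matrix_vector_mul_component column_def transpose_def inner_vec_def)
  note agree[OF this]
  \<comment> \<open>Only indices i \<ge> j occur in the \<open>u\<close> expansion of
    \<open>x\<close>, and only i \<le> j + d in its \<open>v\<close> expansion. The two forms agree
    at \<open>x\<close>, so their common value is bounded from both sides.\<close>
  moreover have "x \<bullet> (M' *v x) \<le> m j * (x \<bullet> x)"
  proof (rule eigenbasis_inner_le[OF e'])
    fix i assume "i < ?p" "u i \<bullet> x \<noteq> 0"
    then have "\<not> i < j" using x[of "u i"] by auto
    then show "m i \<le> m j" using ord' \<open>i < ?p\<close> by simp
  qed
  moreover have "l (j + ?d) * (x \<bullet> x) \<le> x \<bullet> (M *v x)"
  proof (rule eigenbasis_inner_ge[OF e])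
    fix i assume "i < ?p" "v i \<bullet> x \<noteq> 0"
    then have "\<not> j + ?d < i" using x[of "v i"] by auto
    then show "l (j + ?d) \<le> l i" using ord j by simp
  qed
  ultimately have "l (j + ?d) * (x \<bullet> x) \<le> m j * (x \<bullet> x)" by linarith
  then show ?thesis using \<open>x \<noteq> 0\<close> by simp
qed

text \<open>The determinant is the product of the factors \<open>1 + m j\<close>. Its last d factors
  are at least 1 and are dropped; Weyl's inequality compares the others with the factors of
  \<open>M\<close> shifted by d.\<close>

lemma det_low_rank_ge:
  fixes M M' :: "real^'p^'p" and A :: "real^'d^'p"
  assumes M: "pos_semidef M" and M': "pos_semidef M'" and d: "CARD('d) \<le> CARD('p)"
    and e: "eigenbasis M v l" and ord: "\<And>i j. i \<le> j \<Longrightarrow> j < CARD('p) \<Longrightarrow> l j \<le> l i"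
    and agree: "\<And>x. transpose A *v x = 0 \<Longrightarrow> x \<bullet> (M' *v x) = x \<bullet> (M *v x)"
  shows "(\<Prod>j\<in>{CARD('d)..<CARD('p)}. 1 + l j) \<le> det (mat 1 + M')"
proof -
  let ?d = "CARD('d)" and ?p = "CARD('p)"
  obtain u m where e': "eigenbasis M' u m" and ord': "\<And>i j. i \<le> j \<Longrightarrow> j < ?p \<Longrightarrow> m j \<le> m i"
    using ex_ordered_eigenbasis M' unfolding pos_semidef_def by metis
  note l0 = pos_semidef_eigenvalue_nonneg[OF M e] and m0 = pos_semidef_eigenvalue_nonneg[OF M' e']
  have "(\<Prod>j\<in>{?d..<?p}. 1 + l j) = (\<Prod>j<?p - ?d. 1 + l (j + ?d))"
    using prod.shift_bounds_nat_ivl[of "\<lambda>j. 1 + l j" 0 ?d "?p - ?d"] d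
    by (simp add: lessThan_atLeast0)
  also have "\<dots> \<le> (\<Prod>j<?p - ?d. 1 + m j)"
    by (rule prod_mono) (use weyl_low_rank[OF e ord e' ord' agree] l0 in \<open>auto simp: less_diff_conv add_nonneg_nonneg\<close>)
  also have "\<dots> \<le> (\<Prod>j<?p. 1 + m j)"
    by (rule prod_mono2) (auto simp: m0 add_nonneg_nonneg)
  also have "\<dots> = det (mat 1 + M')"
    by (rule eigenbasis_det[OF eigenbasis_add_mat_1[OF e'], symmetric])
  finally show ?thesis .
qed

text \<open>\<open>V ** transpose V\<close> is the orthogonal projection onto the span of the first
  d basis vectors. The numbering \<open>e\<close> only permutes the columns of \<open>V\<close> and
  leaves this product unchanged.\<close>

lemma outer_projection_eigenvector:
  fixes v :: "nat \<Rightarrow> real^'p" and e :: "'d::finite \<Rightarrow> nat"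
  assumes on: "orthonormal_seq v" and e: "bij_betw e UNIV {..<CARD('d)}"
    and d: "CARD('d) \<le> CARD('p)" and V: "V = (\<chi> i k. v (e k) $ i)" and j: "j < CARD('p)"
  shows "V *v (transpose V *v v j) = (if j < CARD('d) then v j else 0)"
proof -
  have "transpose V *v v j = (\<chi> k. v (e k) \<bullet> v j)"
    by (simp add: V matrix_vector_mult_def transpose_def inner_vec_def vec_eq_iff)
  then have "V *v (transpose V *v v j) = (\<Sum>k\<in>UNIV. (v (e k) \<bullet> v j) *\<^sub>R v (e k))"
    by (simp add: V matrix_vector_mult_def vec_eq_iff mult.commute)
  also have "\<dots> = (\<Sum>i<CARD('d). (v i \<bullet> v j) *\<^sub>R v i)"
    by (rule sum.reindex_bij_betw[OF e])
  also have "\<dots> = (\<Sum>i<CARD('d). if i = j then v j else 0)"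
    by (rule sum.cong) (use on d j in \<open>auto simp: orthonormal_seq_def\<close>)
  finally show ?thesis by simp
qed

text \<open>An Eckart-Young theorem for the determinant in place of a norm: the projected residual
  keeps the eigenvectors of \<open>K ** transpose K\<close> and loses exactly the d largest
  eigenvalues, which meets the lower bound valid for every competitor.\<close>

theorem det_low_rank_approximation:
  fixes K :: "real^'n^'p" and V A :: "real^'d^'p" and B :: "real^'n^'d"
  assumes d: "CARD('d) \<le> CARD('p)" and V: "leading_eigenvectors (K ** transpose K) V"
  shows "det (mat 1 + (K - V ** transpose V ** K) ** transpose (K - V ** transpose V ** K))
    \<le> det (mat 1 + (K - A ** B) ** transpose (K - A ** B))"
proof -
  let ?d = "CARD('d)" and ?p = "CARD('p)"
  from V[unfolded leading_eigenvectors_def] obtain v lam e where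
    v: "\<forall>i<?p. \<forall>j<?p. v i \<bullet> v j = (if i = j then 1 else 0)"
    "\<forall>j<?p. (K ** transpose K) *v v j = (lam j)\<^sup>2 *\<^sub>R v j"
    and ord: "\<forall>i j. i \<le> j \<longrightarrow> j < ?p \<longrightarrow> (lam j)\<^sup>2 \<le> (lam i)\<^sup>2"
    and e: "bij_betw e (UNIV :: 'd set) {..<?d}" and V_eq: "V = (\<chi> i k. v (e k) $ i)"
    by (elim exE conjE)
  define l where "l j = (lam j)\<^sup>2" for j
  have on: "orthonormal_seq v" using v by (simp add: orthonormal_seq_def)
  have eig: "eigenbasis (K ** transpose K) v l"
    using v by (simp add: eigenbasis_def on l_def)
  define N where "N = K - V ** transpose V ** K"
  have N: "N = (mat 1 - V ** transpose V) ** K"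
    by (simp add: N_def matrix_diff_rdistrib)
  have "(N ** transpose N) *v v j = (if j < ?d then 0 else l j) *\<^sub>R v j" if j: "j < ?p" for j
  proof -
    let ?P = "mat 1 - V ** transpose V"
    have P: "?P *v v j = (if j < ?d then 0 else v j)"
      using outer_projection_eigenvector[OF on e d V_eq j]
      by (simp add: matrix_vector_mult_diff_rdistrib matrix_vector_mul_assoc)
    have "transpose ?P = ?P"
      by (simp add: transpose_diff matrix_transpose_mul)
    then have "(N ** transpose N) *v v j = ?P *v ((K ** transpose K) *v (?P *v v j))"
      by (simp add: N matrix_transpose_mul matrix_mul_assoc matrix_vector_mul_assoc)
    then show ?thesis
      using eig j P by (simp add: eigenbasis_def matrix_vector_mult_scaleR)
  qed
  then have "eigenbasis (N ** transpose N) v (\<lambda>j. if j < ?d then 0 else l j)"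
    by (simp add: eigenbasis_def on)
  then have "det (mat 1 + N ** transpose N) = (\<Prod>j<?p. 1 + (if j < ?d then 0 else l j))"
    by (intro eigenbasis_det eigenbasis_add_mat_1)
  also have "\<dots> = (\<Prod>j\<in>{?d..<?p}. 1 + l j)"
    by (rule prod.mono_neutral_cong_right) auto
  also have "\<dots> \<le> det (mat 1 + (K - A ** B) ** transpose (K - A ** B))"
  proof (rule det_low_rank_ge[OF pos_semidef_gram' pos_semidef_gram' d eig])
    show "l j \<le> l i" if "i \<le> j" "j < ?p" for i j
      using ord that by (simp add: l_def)
    fix x assume x: "transpose A *v x = 0"
    \<comment> \<open>The competitor is invisible on the kernel of \<open>transpose A\<close>, so
      both Gram matrices define the same form there.\<close>
    have "transpose (K - A ** B) *v x = transpose K *v x"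
      using x by (simp add: transpose_diff matrix_transpose_mul matrix_vector_mult_diff_rdistrib
          matrix_vector_mul_assoc[symmetric])
    then show "x \<bullet> (((K - A ** B) ** transpose (K - A ** B)) *v x) = x \<bullet> ((K ** transpose K) *v x)"
      by (simp add: matrix_vector_mul_assoc[symmetric] inner_matrix_transpose)
  qed
  finally show ?thesis by (simp add: N_def)
qed

section \<open>Reduced rank least squares\<close>

text \<open>Common form of \<open>Delta_LS\<close> and \<open>Delta_hat\<close>, with the
  coefficient matrix left free.\<close>

definition residual_cov :: "real^'p^'n \<Rightarrow> real^'r^'n \<Rightarrow> real^'r^'p \<Rightarrow> real^'p^'p" where
  "residual_cov Xb Fb C = (1 / real CARD('n)) *\<^sub>R
     (transpose (Xb - Fb ** transpose C) ** (Xb - Fb ** transpose C))"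

lemma Delta_LS_residual_cov: "Delta_LS Xb Fb = residual_cov Xb Fb (C_LS Xb Fb)"
  by (simp add: Delta_LS_def residual_cov_def)

lemma Delta_hat_residual_cov: "Delta_hat Xb Fb A B = residual_cov Xb Fb (A ** B)"
proof -
  have "transpose Xb - A ** B ** transpose Fb = transpose (Xb - Fb ** transpose (A ** B))"
    by (simp add: transpose_diff matrix_transpose_mul)
  then show ?thesis
    by (simp add: Delta_hat_def residual_cov_def)
qed

lemma pos_semidef_residual_cov: "pos_semidef (residual_cov Xb Fb C)"
  unfolding residual_cov_def by (intro pos_semidef_scaleR pos_semidef_gram) simp

text \<open>Pythagoras for least squares: the residual \<open>E\<close> is orthogonal to the columns
  of \<open>Fb\<close>, so the cross terms vanish and any other coefficient adds a Gram
  matrix.\<close>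

lemma residual_cov_eq:
  fixes Xb :: "real^'p^'n" and Fb :: "real^'r^'n" and C :: "real^'r^'p"
  assumes inv: "invertible (Sigma_hat Fb Fb)"
  defines "Z \<equiv> (1 / sqrt CARD('n)) *\<^sub>R ((C_LS Xb Fb - C) ** transpose Fb)"
  shows "residual_cov Xb Fb C = Delta_LS Xb Fb + Z ** transpose Z"
proof -
  define D where "D = (C_LS Xb Fb - C) ** transpose Fb"
  define E where "E = Xb - Fb ** transpose (C_LS Xb Fb)"
  let ?n = "real CARD('n)"
  \<comment> \<open>These are the normal equations; they give the orthogonality of \<open>E\<close>
    and \<open>Fb\<close>.\<close>
  have "C_LS Xb Fb ** Sigma_hat Fb Fb = Sigma_hat Xb Fb"
    by (simp add: C_LS_def matrix_inv_works(2)[OF inv] flip: matrix_mul_assoc)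
  then have "(1 / ?n) *\<^sub>R (C_LS Xb Fb ** (transpose Fb ** Fb)) = (1 / ?n) *\<^sub>R (transpose Xb ** Fb)"
    by (simp add: Sigma_hat_def matrix_mul_scaleR)
  then have "transpose E ** Fb = 0"
    by (simp add: E_def transpose_diff matrix_transpose_mul matrix_diff_rdistrib matrix_mul_assoc)
  then have E: "transpose E ** (Fb ** M) = 0" for M :: "real^'p^'r"
    by (simp add: matrix_mul_assoc)
  have "transpose E ** transpose D = 0"
    using E by (simp add: D_def matrix_transpose_mul)
  moreover from this have "D ** E = 0"
    by (metis matrix_transpose_mul transpose_iff transpose_mat mat_0 transpose_transpose)
  moreover have "Xb - Fb ** transpose C = E + transpose D"
    by (simp add: E_def D_def transpose_diff matrix_transpose_mul matrix_diff_ldistrib)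
  ultimately have "transpose (Xb - Fb ** transpose C) ** (Xb - Fb ** transpose C)
      = transpose E ** E + D ** transpose D"
    by (simp add: transpose_add matrix_add_ldistrib matrix_add_rdistrib)
  moreover have "Z ** transpose Z = (1 / ?n) *\<^sub>R (D ** transpose D)"
    by (simp add: Z_def D_def transpose_scalar matrix_mul_scaleR)
  ultimately show ?thesis
    by (simp add: residual_cov_def Delta_LS_def E_def scaleR_add_right)
qed

lemma pos_def_Delta_LS:
  "invertible (Delta_LS Xb Fb) \<Longrightarrow> pos_def (Delta_LS Xb Fb)"
  by (metis Delta_LS_residual_cov pos_semidef_invertible_imp_pos_def pos_semidef_residual_cov)

lemma pos_def_residual_cov:
  assumes "invertible (Sigma_hat Fb Fb)" "invertible (Delta_LS Xb Fb)"
  shows "pos_def (residual_cov Xb Fb C)"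
  unfolding residual_cov_eq[OF assms(1)]
  by (intro pos_def_add_pos_semidef pos_def_Delta_LS pos_semidef_gram' assms)

text \<open>Factoring \<open>R\<close>, the square root of \<open>Delta_LS\<close>, out on both
  sides leaves the determinant of the identity plus a Gram matrix, to which the low rank
  approximation theorem applies.\<close>

lemma det_residual_cov_minimal:
  fixes Xb :: "real^'p^'n" and Fb :: "real^'r^'n" and V A :: "real^'d^'p" and B :: "real^'r^'d"
  assumes d: "CARD('d) \<le> CARD('p)"
    and inv: "invertible (Sigma_hat Fb Fb)" and invD: "invertible (Delta_LS Xb Fb)"
    and V: "leading_eigenvectors (Sigma_fit Xb Fb) V"
  shows "det (residual_cov Xb Fb (A_hat Xb Fb V ** B_hat Xb Fb V))
    \<le> det (residual_cov Xb Fb (A ** B))"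
proof -
  define R where "R = msqrt (Delta_LS Xb Fb)"
  define Ri where "Ri = matrix_inv R"
  define c where "c = 1 / sqrt CARD('n)"
  \<comment> \<open>The whitened fitted values. Scaling \<open>transpose Fb\<close> by
    \<open>c\<close> replaces the square root of \<open>Sigma_hat Fb Fb\<close>: both have the same
    Gram matrix, so \<open>K ** transpose K\<close> is \<open>Sigma_fit\<close>.\<close>
  define K where "K = c *\<^sub>R (Ri ** C_LS Xb Fb ** transpose Fb)"
  have R: "pos_def R" "R ** R = Delta_LS Xb Fb"
    using msqrt_works[OF pos_def_Delta_LS[OF invD]] by (auto simp: R_def)
  have RRi: "R ** Ri = mat 1" "Ri ** R = mat 1"
    using matrix_inv_works[OF pos_def_invertible[OF R(1)]] by (auto simp: Ri_def)
  have symR: "transpose R = R" and symRi: "transpose Ri = Ri"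
    using R(1) pos_def_matrix_inv[OF R(1)] by (auto simp: pos_def_def Ri_def)
  have det_eq: "det (residual_cov Xb Fb C) = det (Delta_LS Xb Fb) * det (mat 1 + N ** transpose N)"
    if N: "N = K - c *\<^sub>R (Ri ** C ** transpose Fb)" for C N
  proof -
    have "R ** N = c *\<^sub>R ((C_LS Xb Fb - C) ** transpose Fb)"
      by (simp add: N K_def matrix_diff_ldistrib matrix_diff_rdistrib matrix_mul_scaleR
          matrix_mul_assoc RRi scaleR_diff_right)
    then have "residual_cov Xb Fb C = R ** R + (R ** N) ** transpose (R ** N)"
      using residual_cov_eq[OF inv, of Xb C] R(2) by (simp add: c_def)
    also have "\<dots> = R ** (mat 1 + N ** transpose N) ** R"
      by (simp add: matrix_add_ldistrib matrix_add_rdistrib matrix_transpose_mul symR matrix_mul_assoc)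
    finally show ?thesis
      by (simp add: det_mul flip: R(2))
  qed
  have "Sigma_fit Xb Fb = K ** transpose K"
  proof -
    have symF: "transpose (Sigma_hat Fb Fb) = Sigma_hat Fb Fb"
      by (simp add: Sigma_hat_def transpose_scalar matrix_transpose_mul)
    have FF: "(c * c) *\<^sub>R (transpose Fb ** Fb) = Sigma_hat Fb Fb"
      by (simp add: c_def Sigma_hat_def)
    have "K ** transpose K = Ri ** C_LS Xb Fb ** ((c * c) *\<^sub>R (transpose Fb ** Fb))
        ** transpose (C_LS Xb Fb) ** Ri"
      by (simp add: K_def transpose_scalar matrix_transpose_mul symRi matrix_mul_scaleR
          matrix_mul_assoc)
    also have "\<dots> = Ri ** Sigma_hat Xb Fb ** (matrix_inv (Sigma_hat Fb Fb) ** Sigma_hat Fb Fb)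
        ** matrix_inv (Sigma_hat Fb Fb) ** transpose (Sigma_hat Xb Fb) ** Ri"
      unfolding FF
      by (simp add: C_LS_def matrix_transpose_mul transpose_matrix_inv[OF inv] symF matrix_mul_assoc)
    finally show ?thesis
      by (simp add: Sigma_fit_def Ri_def R_def matrix_inv_works(2)[OF inv])
  qed
  with V have V': "leading_eigenvectors (K ** transpose K) V" by simp
  \<comment> \<open>The factor \<open>R\<close> in \<open>A_hat\<close> cancels against
    \<open>Ri\<close>, so the estimators correspond to projecting \<open>K\<close> by
    \<open>V ** transpose V\<close>.\<close>
  have "Ri ** (A_hat Xb Fb V ** B_hat Xb Fb V) = V ** transpose V ** (Ri ** C_LS Xb Fb)"
    by (simp add: A_hat_def B_hat_def C_LS_def RRi matrix_mul_assoc flip: R_def Ri_def)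
  then have hat: "K - V ** transpose V ** K =
      K - c *\<^sub>R (Ri ** (A_hat Xb Fb V ** B_hat Xb Fb V) ** transpose Fb)"
    by (simp add: K_def matrix_mul_scaleR matrix_mul_assoc)
  \<comment> \<open>Grouped this way, the competitor visibly factors through dimension d.\<close>
  have gen: "K - (Ri ** A) ** (c *\<^sub>R (B ** transpose Fb)) = K - c *\<^sub>R (Ri ** (A ** B) ** transpose Fb)"
    by (simp add: matrix_mul_scaleR matrix_mul_assoc)
  have "0 < det (Delta_LS Xb Fb)"
    by (rule pos_def_det_pos[OF pos_def_Delta_LS[OF invD]])
  then show ?thesis
    unfolding det_eq[OF hat] det_eq[OF gen]
    using det_low_rank_approximation[OF d V'] by (simp add: mult_left_mono)
qed

section \<open>The likelihood of the spatial error model\<close>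

text \<open>Column normalization alone need not give a symmetric matrix; symmetry is forced by the
  prescribed covariance. With H the inverse of \<open>G\<close>, the model gives H times its
  transpose where H squared is prescribed, and H can be cancelled.\<close>

lemma W_of_symmetric:
  fixes W :: "real^'n^'n"
  assumes G: "G = W_of \<theta> W" and inv: "invertible G"
    and cov: "\<And>\<Delta> :: real^'p^'p. pos_def \<Delta> \<Longrightarrow>
      sem_error_cov \<theta> W \<Delta> = kron (matrix_inv (G ** G)) \<Delta>"
  shows "transpose G = G"
proof -
  let ?H = "matrix_inv G"
  have H: "matrix_inv (G ** G) = ?H ** ?H"
  proof (rule matrix_inv_unique)
    have "G ** G ** (?H ** ?H) = G ** (G ** ?H) ** ?H"
      by (simp add: matrix_mul_assoc)
    then show "G ** G ** (?H ** ?H) = mat 1"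
      by (simp add: matrix_inv_works[OF inv])
  qed
  have "kron (?H ** transpose ?H) (mat 1 :: real^'p^'p) = kron (?H ** ?H) (mat 1)"
    using cov[OF pos_def_mat_1]
    by (simp add: sem_error_cov_def transpose_kron kron_mult H flip: G)
  then have "?H ** transpose ?H = ?H ** ?H"
    by (rule kron_mat_1_cancel)
  then have "transpose ?H = ?H"
    by (metis inv matrix_inv_works(1) matrix_mul_assoc matrix_mul_lid)
  then show ?thesis
    by (metis inv matrix_inv_unique matrix_inv_works(1) invertible_matrix_inv transpose_matrix_inv matrix_inv_works(2))
qed

lemma residual_sem_mean:
  "X - sem_mean F \<mu> A B = X - outer 1 \<mu> - F ** transpose B ** transpose A"
  by (simp add: sem_mean_def matrix_transpose_mul matrix_mul_assoc diff_diff_eq)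

lemma sem_loglik_eq:
  fixes X :: "real^'p^'n" and W :: "real^'n^'n" and F :: "real^'r^'n"
    and A :: "real^'d^'p" and B :: "real^'r^'d"
  assumes G: "G = W_of \<theta> W" and inv: "invertible G" and sym: "transpose G = G"
    and \<Delta>: "pos_def \<Delta>"
  shows "sem_loglik \<theta> W F X \<mu> A B \<Delta> =
    - (real CARD('n) * real CARD('p) / 2) * ln (2 * pi)
    - (real CARD('n) / 2) * ln (det \<Delta>)
    + real CARD('p) * ln \<bar>det G\<bar>
    - (1/2) * trace (G ** (X - outer 1 \<mu> - F ** transpose B ** transpose A) ** matrix_inv \<Delta>
        ** transpose (X - outer 1 \<mu> - F ** transpose B ** transpose A) ** G)"
proof -
  let ?n = "CARD('n)" and ?p = "CARD('p)"
  define E where "E = X - outer 1 \<mu> - F ** transpose B ** transpose A"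
  define S where "S = kron (matrix_inv (G ** G)) \<Delta>"
  have invGG: "invertible (G ** G)" using inv by (simp add: invertible_mult)
  have sym\<Delta>: "transpose \<Delta> = \<Delta>" using \<Delta> by (simp add: pos_def_def)
  have dG: "det G \<noteq> 0" using inv by (simp add: invertible_det_nz)
  have d\<Delta>: "0 < det \<Delta>" by (rule pos_def_det_pos[OF \<Delta>])
  have "transpose (G ** G) = G ** G" by (simp add: matrix_transpose_mul sym)
  then have "transpose (matrix_inv (G ** G)) = matrix_inv (G ** G)"
    by (simp add: transpose_matrix_inv[OF invGG])
  \<comment> \<open>The exponent is even, so the absolute value may be inserted; logarithms then
    apply whatever the sign of \<open>det G\<close>.\<close>
  then have detS: "det S = inverse (\<bar>det G\<bar> ^ (2 * ?p)) * det \<Delta> ^ ?n"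
    by (simp add: S_def det_kron_symmetric sym\<Delta> det_matrix_inv[OF invGG] det_mul power_mult
        power2_eq_square power_inverse power_mult_distrib)
  have "0 < inverse (\<bar>det G\<bar> ^ (2 * ?p))" "0 < det \<Delta> ^ ?n"
    using dG d\<Delta> by auto
  then have "ln (det S) = ?n * ln (det \<Delta>) - 2 * ?p * ln \<bar>det G\<bar>"
    unfolding detS using dG d\<Delta> by (simp add: ln_mult ln_inverse ln_realpow)
  moreover have posS: "0 < det S"
    unfolding detS using dG d\<Delta> by simp
  ultimately have lnsqrt: "ln (sqrt ((2 * pi) ^ CARD('n \<times> 'p) * det S)) =
      (real ?n * real ?p * ln (2 * pi) + ?n * ln (det \<Delta>) - 2 * ?p * ln \<bar>det G\<bar>) / 2"
    by (simp add: ln_sqrt ln_mult ln_realpow field_simps)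
  have "vec_rows X - vec_rows (sem_mean F \<mu> A B) = vec_rows E"
    by (simp add: E_def flip: residual_sem_mean) (simp add: vec_rows_def vec_eq_iff)
  moreover have "matrix_inv S = kron (G ** G) (matrix_inv \<Delta>)"
    unfolding S_def
    by (simp add: matrix_inv_kron invertible_matrix_inv invGG pos_def_invertible[OF \<Delta>]
        matrix_inv_unique[OF matrix_inv_works(2)[OF invGG]])
  \<comment> \<open>Cyclicity of the trace moves one of the two factors \<open>G\<close> to the
    front.\<close>
  moreover have "trace (E ** matrix_inv \<Delta> ** transpose E ** transpose (G ** G)) =
      trace (G ** E ** matrix_inv \<Delta> ** transpose E ** G)"
    by (subst (2) trace_mul_sym, subst trace_mul_sym)
      (simp add: matrix_transpose_mul sym matrix_mul_assoc)
  ultimately have "sem_loglik \<theta> W F X \<mu> A B \<Delta> =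
      ln (exp (- (1/2) * trace (G ** E ** matrix_inv \<Delta> ** transpose E ** G)) /
        sqrt ((2 * pi) ^ CARD('n \<times> 'p) * det S))"
    by (simp add: sem_loglik_def mvn_density_def inner_vec_rows_kron flip: G S_def)
  also have "\<dots> = - (1/2) * trace (G ** E ** matrix_inv \<Delta> ** transpose E ** G)
      - (real ?n * real ?p * ln (2 * pi) + ?n * ln (det \<Delta>) - 2 * ?p * ln \<bar>det G\<bar>) / 2"
  proof -
    have "ln (exp a / sqrt Q) = a - ln (sqrt Q)" if "0 < Q" for a Q :: real
      using that by (simp add: ln_div)
    moreover have "0 < (2 * pi) ^ CARD('n \<times> 'p) * det S"
      using posS by simp
    ultimately show ?thesis
      by (simp only: lnsqrt)
  qed
  finally show ?thesis
    by (simp add: E_def field_simps)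
qed

section \<open>Rank one matrices and centring\<close>

lemma matrix_mul_outer: "M ** outer u v = outer (M *v u) v"
  by (simp add: matrix_matrix_mult_def matrix_vector_mult_def outer_def vec_eq_iff
      sum_distrib_left ac_simps)

lemma outer_matrix_mul: "outer u v ** M = outer u (transpose M *v v)"
  by (simp add: matrix_matrix_mult_def matrix_vector_mult_def outer_def vec_eq_iff
      transpose_def sum_distrib_left ac_simps)

lemma transpose_outer: "transpose (outer u v) = outer v u"
  by (simp add: outer_def transpose_def vec_eq_iff mult.commute)

lemma outer_vector_mul: "outer u v *v x = (v \<bullet> x) *\<^sub>R u"
  by (simp add: outer_def matrix_vector_mult_def vec_eq_iff inner_vec_def sum_distrib_left ac_simps)

lemma outer_simps: "outer 0 v = 0" "outer u 0 = 0" "outer (c *\<^sub>R u) v = c *\<^sub>R outer u v"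
  by (simp_all add: outer_def vec_eq_iff)

lemma trace_mul_outer: "trace (M ** outer u v) = v \<bullet> (M *v u)"
  by (simp only: matrix_mul_outer) (simp add: trace_def outer_def inner_vec_def mult.commute)

text \<open>\<open>G W\<^sub>c = P G\<close>, where \<open>P\<close> is the orthogonal projection onto the complement of \<open>m = G 1\<close>; hence
  the sum of squares splits into the centred part and a rank one term that vanishes at \<open>mu_hat\<close>.\<close>
lemma centred_sum_of_squares:
  fixes X :: "real^'p^'n" and W :: "real^'n^'n" and F :: "real^'r^'n"
    and A :: "real^'d^'p" and B :: "real^'r^'d"
  assumes G: "G = W_of \<theta> W" and inv: "invertible G" and sym: "transpose G = G"
    and Xb: "Xb = sem_bar \<theta> W X" and Fb: "Fb = sem_bar \<theta> W F"
    and E: "E = X - outer 1 \<mu> - F ** transpose B ** transpose A"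
  obtains q where "0 < q"
    "(1 / real CARD('n)) *\<^sub>R (transpose (G ** E) ** (G ** E)) = residual_cov Xb Fb (A ** B) +
      q *\<^sub>R outer (mu_hat \<theta> W X F A B - \<mu>) (mu_hat \<theta> W X F A B - \<mu>)"
proof -
  define m where "m = G *v 1"
  define c where "c = inverse (m \<bullet> m)"
  define H where "H = X - F ** transpose (A ** B)"
  \<comment> \<open>The generalized least squares intercept for fixed \<open>A ** B\<close>; it
    turns out to be \<open>mu_hat\<close>.\<close>
  define \<nu> where "\<nu> = c *\<^sub>R (transpose H *v (G *v m))"
  define \<delta> where "\<delta> = \<nu> - \<mu>"
  define U where "U = Xb - Fb ** transpose (A ** B)"
  have "m \<noteq> 0"
  proof
    assume "m = 0"
    then have "matrix_inv G *v (G *v 1) = 0" by (simp add: m_def)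
    then show False
      by (simp add: matrix_vector_mul_assoc matrix_inv_works[OF inv])
  qed
  then have mm: "0 < m \<bullet> m" by simp
  have GG: "(G ** G) *v 1 = G *v m"
    by (simp add: m_def matrix_vector_mul_assoc)
  have c: "inverse (1 \<bullet> (G *v m)) = c"
    by (simp add: c_def m_def inner_matrix_transpose[of 1] sym)
  have \<nu>: "mu_hat \<theta> W X F A B = \<nu>"
    by (simp add: mu_hat_def GG c \<nu>_def H_def transpose_diff matrix_transpose_mul matrix_mul_assoc
        flip: G)
  have o: "outer 1 1 ** (G ** G) = outer 1 (G *v m)"
    by (simp add: outer_matrix_mul matrix_transpose_mul sym m_def matrix_vector_mul_assoc)
  have GW: "G ** W_center \<theta> W = G - c *\<^sub>R outer m (G *v m)"
    by (simp add: W_center_def GG c o matrix_diff_ldistrib matrix_mul_scaleR matrix_mul_outer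
        flip: G m_def)
  have "U = G ** W_center \<theta> W ** H"
    by (simp add: U_def Xb Fb sem_bar_def H_def matrix_diff_ldistrib matrix_mul_assoc flip: G)
  also have "\<dots> = G ** H - outer m \<nu>"
    by (simp add: GW matrix_diff_rdistrib matrix_mul_scaleR outer_matrix_mul \<nu>_def)
      (simp add: outer_def vec_eq_iff)
  finally have U: "U = G ** H - outer m \<nu>" .
  \<comment> \<open>The centred residual is orthogonal to \<open>m\<close>, which removes the cross
    terms between \<open>U\<close> and \<open>outer m \<delta>\<close>.\<close>
  have "transpose U *v m = 0"
    using mm by (simp add: U transpose_diff transpose_outer matrix_vector_mult_diff_rdistrib
        outer_vector_mul matrix_transpose_mul sym \<nu>_def c_def matrix_vector_mul_assoc)
  moreover have "E = H - outer 1 \<mu>"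
    by (simp add: E H_def matrix_transpose_mul matrix_mul_assoc algebra_simps)
  then have GE: "G ** E = U + outer m \<delta>"
    by (simp add: U matrix_diff_ldistrib matrix_mul_outer \<delta>_def flip: m_def)
      (simp add: outer_def vec_eq_iff algebra_simps)
  ultimately have "transpose (G ** E) ** (G ** E) = transpose U ** U + (m \<bullet> m) *\<^sub>R outer \<delta> \<delta>"
    by (simp add: transpose_add matrix_add_ldistrib matrix_add_rdistrib transpose_outer
        matrix_vector_mult_add_rdistrib matrix_mul_outer outer_matrix_mul outer_vector_mul outer_simps)
  then have "(1 / real CARD('n)) *\<^sub>R (transpose (G ** E) ** (G ** E)) =
      residual_cov Xb Fb (A ** B) + (m \<bullet> m / real CARD('n)) *\<^sub>R outer \<delta> \<delta>"
    by (simp add: residual_cov_def U_def scaleR_add_right)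
  then show thesis
    using that[of "m \<bullet> m / real CARD('n)"] mm by (simp add: \<nu> \<delta>_def)
qed

theorem proposition4p1:
  fixes X :: "real^'p^'n" and Y :: "real^'n" and f :: "real \<Rightarrow> real^'r"
    and s :: "'n \<Rightarrow> real^2" and dmax \<theta> :: real and W W\<^sub>\<theta> :: "real^'n^'n"
    and F Fb :: "real^'r^'n" and Xb :: "real^'p^'n"
    and V Ah :: "real^'d^'p" and Bh :: "real^'r^'d"
  assumes d_le_p: "CARD('d) \<le> CARD('p)"
    and F_def: "F = (\<chi> i. f (Y $ i))"
    and weights: "spatial_weight_matrix s dmax W"
    and W\<theta>_def: "W\<^sub>\<theta> = W_of \<theta> W"
    and W\<theta>_inv: "invertible W\<^sub>\<theta>"
    and error_cov: "\<forall>\<Delta> :: real^'p^'p. pos_def \<Delta> \<longrightarrow>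
          sem_error_cov \<theta> W \<Delta> = kron (matrix_inv (W\<^sub>\<theta> ** W\<^sub>\<theta>)) \<Delta>"
    and Xb_def: "Xb = sem_bar \<theta> W X"
    and Fb_def: "Fb = sem_bar \<theta> W F"
    and Sigma_FF_inv: "invertible (Sigma_hat Fb Fb)"
    and Delta_LS_inv: "invertible (Delta_LS Xb Fb)"
    and V: "leading_eigenvectors (Sigma_fit Xb Fb) V"
    and Ah_def: "Ah = A_hat Xb Fb V"
    and Bh_def: "Bh = B_hat Xb Fb V"
  shows "(\<forall>(\<mu> :: real^'p) (A :: real^'d^'p) (B :: real^'r^'d) (\<Delta> :: real^'p^'p). pos_def \<Delta> \<longrightarrow>
            sem_loglik \<theta> W F X \<mu> A B \<Delta> =
              - (real CARD('n) * real CARD('p) / 2) * ln (2 * pi)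
              - (real CARD('n) / 2) * ln (det \<Delta>)
              + real CARD('p) * ln \<bar>det W\<^sub>\<theta>\<bar>
              - (1/2) * trace (W\<^sub>\<theta> ** (X - outer 1 \<mu> - F ** transpose B ** transpose A)
                  ** matrix_inv \<Delta>
                  ** transpose (X - outer 1 \<mu> - F ** transpose B ** transpose A) ** W\<^sub>\<theta>))
       \<and> is_arg_max
            (\<lambda>(\<mu>, A, B, \<Delta>). sem_loglik \<theta> W F X \<mu> A B \<Delta>)
            (\<lambda>(\<mu> :: real^'p, A :: real^'d^'p, B :: real^'r^'d, \<Delta> :: real^'p^'p). pos_def \<Delta>)
            (mu_hat \<theta> W X F Ah Bh, Ah, Bh, Delta_hat Xb Fb Ah Bh)"
proof -
  have sym: "transpose W\<^sub>\<theta> = W\<^sub>\<theta>"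
    by (rule W_of_symmetric[OF W\<theta>_def W\<theta>_inv]) (use error_cov in blast)
  note loglik = sem_loglik_eq[OF W\<theta>_def W\<theta>_inv sym]
  let ?n = "real CARD('n)"
  \<comment> \<open>Collects the terms that do not depend on the parameters being estimated.\<close>
  define L where "L = real CARD('p) * ln \<bar>det W\<^sub>\<theta>\<bar> - (?n * real CARD('p) / 2) * ln (2 * pi)"
  define S where "S A B = residual_cov Xb Fb (A ** B)" for A :: "real^'d^'p" and B :: "real^'r^'d"
  have S_pos: "pos_def (S A B)" for A B
    unfolding S_def by (rule pos_def_residual_cov[OF Sigma_FF_inv Delta_LS_inv])
  have loglik': "\<exists>q>0. sem_loglik \<theta> W F X \<mu> A B \<Delta> = L - ?n / 2 *
      (ln (det \<Delta>) + trace (matrix_inv \<Delta> ** S A B) +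
        q * ((mu_hat \<theta> W X F A B - \<mu>) \<bullet> (matrix_inv \<Delta> *v (mu_hat \<theta> W X F A B - \<mu>))))"
    if \<Delta>: "pos_def \<Delta>" for \<mu> \<Delta> and A :: "real^'d^'p" and B
  proof -
    define E where "E = X - outer 1 \<mu> - F ** transpose B ** transpose A"
    let ?\<delta> = "mu_hat \<theta> W X F A B - \<mu>"
    obtain q where q: "0 < q" and
      eq: "(1 / ?n) *\<^sub>R (transpose (W\<^sub>\<theta> ** E) ** (W\<^sub>\<theta> ** E)) = S A B + q *\<^sub>R outer ?\<delta> ?\<delta>"
      unfolding S_def
      by (rule centred_sum_of_squares[OF W\<theta>_def W\<theta>_inv sym Xb_def Fb_def E_def])
    have "trace (W\<^sub>\<theta> ** E ** matrix_inv \<Delta> ** transpose E ** W\<^sub>\<theta>) =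
        trace ((W\<^sub>\<theta> ** E) ** (matrix_inv \<Delta> ** transpose (W\<^sub>\<theta> ** E)))"
      by (simp add: matrix_transpose_mul sym matrix_mul_assoc)
    also have "\<dots> = trace (matrix_inv \<Delta> ** (transpose (W\<^sub>\<theta> ** E) ** (W\<^sub>\<theta> ** E)))"
      by (subst trace_mul_sym) (simp add: matrix_mul_assoc)
    also have "\<dots> = ?n * trace (matrix_inv \<Delta> ** (S A B + q *\<^sub>R outer ?\<delta> ?\<delta>))"
      by (simp add: matrix_mul_scaleR trace_scaleR flip: eq)
    also have "\<dots> = ?n * (trace (matrix_inv \<Delta> ** S A B) + q * (?\<delta> \<bullet> (matrix_inv \<Delta> *v ?\<delta>)))"
      by (simp add: matrix_add_ldistrib trace_add matrix_mul_scaleR trace_scaleR trace_mul_outer)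
    finally have "sem_loglik \<theta> W F X \<mu> A B \<Delta> = L - ?n / 2 *
        (ln (det \<Delta>) + trace (matrix_inv \<Delta> ** S A B) + q * (?\<delta> \<bullet> (matrix_inv \<Delta> *v ?\<delta>)))"
      using loglik[OF \<Delta>, of F X \<mu> A B] by (simp add: L_def E_def algebra_simps)
    with q show ?thesis by blast
  qed
  \<comment> \<open>Three losses are bounded in turn: the quadratic term in \<mu> is nonnegative,
    \<Delta> does no better than the residual covariance, and that covariance has no smaller
    determinant than the one at the estimators.\<close>
  have upper: "sem_loglik \<theta> W F X \<mu> A B \<Delta> \<le> L - ?n / 2 * (real CARD('p) + ln (det (S Ah Bh)))"
    if \<Delta>: "pos_def \<Delta>" for \<mu> \<Delta> and A :: "real^'d^'p" and B
  proof -
    let ?\<delta> = "mu_hat \<theta> W X F A B - \<mu>"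
    obtain q where q: "0 < q" and eq: "sem_loglik \<theta> W F X \<mu> A B \<Delta> = L - ?n / 2 *
        (ln (det \<Delta>) + trace (matrix_inv \<Delta> ** S A B) + q * (?\<delta> \<bullet> (matrix_inv \<Delta> *v ?\<delta>)))"
      using loglik'[OF \<Delta>] by metis
    have "0 \<le> q * (?\<delta> \<bullet> (matrix_inv \<Delta> *v ?\<delta>))"
      using q pos_def_imp_pos_semidef[OF pos_def_matrix_inv[OF \<Delta>]] by (simp add: pos_semidef_def)
    moreover have "real CARD('p) + ln (det (S A B)) \<le> ln (det \<Delta>) + trace (matrix_inv \<Delta> ** S A B)"
      by (rule gaussian_loglik_bound[OF \<Delta> S_pos])
    moreover have "det (S Ah Bh) \<le> det (S A B)"
      unfolding S_def Ah_def Bh_def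
      by (rule det_residual_cov_minimal[OF d_le_p Sigma_FF_inv Delta_LS_inv V])
    then have "ln (det (S Ah Bh)) \<le> ln (det (S A B))"
      using pos_def_det_pos[OF S_pos] by simp
    ultimately show ?thesis
      unfolding eq by (intro diff_left_mono mult_left_mono) auto
  qed
  \<comment> \<open>At the estimators the quadratic term is zero and the trace is that of the
    identity, namely p, so the upper bound is attained.\<close>
  have "sem_loglik \<theta> W F X (mu_hat \<theta> W X F Ah Bh) Ah Bh (S Ah Bh)
      = L - ?n / 2 * (real CARD('p) + ln (det (S Ah Bh)))"
    using loglik'[OF S_pos, of "mu_hat \<theta> W X F Ah Bh" Ah Bh Ah Bh]
    by (simp add: matrix_inv_works(2)[OF pos_def_invertible[OF S_pos]] trace_I add.commute)
  moreover have "Delta_hat Xb Fb Ah Bh = S Ah Bh"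
    by (simp add: Delta_hat_residual_cov S_def)
  ultimately have "is_arg_max
            (\<lambda>(\<mu>, A, B, \<Delta>). sem_loglik \<theta> W F X \<mu> A B \<Delta>)
            (\<lambda>(\<mu> :: real^'p, A :: real^'d^'p, B :: real^'r^'d, \<Delta> :: real^'p^'p). pos_def \<Delta>)
            (mu_hat \<theta> W X F Ah Bh, Ah, Bh, Delta_hat Xb Fb Ah Bh)"
    using upper S_pos by (auto simp: is_arg_max_linorder)
  then show ?thesis
    using loglik by blast
qed

end
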